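(* Let $(D,\mu)$ be a measure space and let $H$ be a reproducing kernel Hilbert space of functions on $D$ with kernel $K$, contained in $L_2(D,\mu)$, such that $$\sup_{f\in H\setminus\{0\}}\frac{\|f\|_2^2}{\|f\|_H^2}<\infty,\qquad \|f\|_2\neq 0\ \text{ for all } f\in H\setminus\{0\},\qquad \int_D K(x,x)\,d\mu(x)<\infty .$$ Let $V_m\subsetneq H$ be an $m$-dimensional subspace ($m\ge1$) and let $n\ge m$ be an integer. Let $H_m$ be the $H$-orthogonal complement of $V_m$ in $H$, let $P_m$ be the $H$-orthogonal projection onto $V_m$, let $K_m$ be the reproducing kernel of $(H_m,\|\cdot\|_H)$, and put $$\lambda_m:=\sup_{f\in H_m\setminus\{0\}}\frac{\|f\|_2^2}{\|f\|_H^2},\qquad r:=\sqrt{\frac{m-1}{n}},\qquad s:=\sqrt{\frac{\operatorname{Tr}(K_m)-\lambda_m}{n\,\lambda_m}} .$$ Then there are points $x_1,\dots,x_n\in D$ and weights $w_1,\dots,w_n>0$ such that, for any $f\in H$, the weighted least squares approximation $$\tilde f:=\operatorname*{arg\,min}_{g\in V_m}\sum_{i=1}^n w_i\,|f(x_i)-g(x_i)|^2$$ is uniquely defined and satisfies $$\|f-\tilde f\|_2\ \le\ \Big(1+\frac{1+s}{1-r}\Big)\sqrt{\lambda_m}\,\|f-P_mf\|_H .$$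
   Context: Functions are complex-valued, and $L_2(D,\mu)$ and its subspaces consist of functions, not equivalence classes. $\|\cdot\|_2$ is the norm of $L_2(D,\mu)$. A reproducing kernel Hilbert space on $D$ is a Hilbert space of functions on $D$ with continuous point evaluations; its kernel satisfies $\langle f,K(x,\cdot)\rangle_H=f(x)$. The trace of a kernel is $\operatorname{Tr}(K_m):=\int_D K_m(x,x)\,d\mu(x)$. *)

theory Defs
  imports "HOL-Analysis.Analysis" "HOL-Library.Function_Algebras"
begin

text \<open>A function on \<^term>\<open>D\<close> is represented by its extension by zero to the whole type, so that
  equality on \<^term>\<open>D\<close> is equality of functions and the vector space operations are the pointwise
  ones.\<close>

definition fscale :: "complex \<Rightarrow> ('a \<Rightarrow> complex) \<Rightarrow> 'a \<Rightarrow> complex" where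
  "fscale c f = (\<lambda>x. c * f x)"

global_interpretation fun_vs: vector_space "fscale :: complex \<Rightarrow> ('a \<Rightarrow> complex) \<Rightarrow> 'a \<Rightarrow> complex"
  by unfold_locales (auto simp: fscale_def fun_eq_iff algebra_simps)

definition ip_norm :: "(('a \<Rightarrow> complex) \<Rightarrow> ('a \<Rightarrow> complex) \<Rightarrow> complex) \<Rightarrow> ('a \<Rightarrow> complex) \<Rightarrow> real" where
  "ip_norm ip f = sqrt (Re (ip f f))"

text \<open>Inner products are linear in the first argument. Only the values of \<^term>\<open>ip\<close> on
  \<^term>\<open>H\<close> are relevant.\<close>

locale function_inner_space =
  fixes D :: "'a set"
    and H :: "('a \<Rightarrow> complex) set"
    and ip :: "('a \<Rightarrow> complex) \<Rightarrow> ('a \<Rightarrow> complex) \<Rightarrow> complex"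
  assumes subspace: "fun_vs.subspace H"
    and zero_outside: "\<And>f x. f \<in> H \<Longrightarrow> x \<notin> D \<Longrightarrow> f x = 0"
    and ip_add_left: "\<And>f g h. f \<in> H \<Longrightarrow> g \<in> H \<Longrightarrow> h \<in> H \<Longrightarrow> ip (f + g) h = ip f h + ip g h"
    and ip_scale_left: "\<And>c f g. f \<in> H \<Longrightarrow> g \<in> H \<Longrightarrow> ip (fscale c f) g = c * ip f g"
    and ip_cnj: "\<And>f g. f \<in> H \<Longrightarrow> g \<in> H \<Longrightarrow> ip g f = cnj (ip f g)"
    and ip_pos: "\<And>f. f \<in> H \<Longrightarrow> f \<noteq> 0 \<Longrightarrow> 0 < Re (ip f f)"
begin

text \<open>\<^locale>\<open>Metric_space\<close> demands nonnegativity and symmetry also off the carrier, hence the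
  case distinction.\<close>

definition ip_dist :: "('a \<Rightarrow> complex) \<Rightarrow> ('a \<Rightarrow> complex) \<Rightarrow> real" where
  "ip_dist f g = (if f \<in> H \<and> g \<in> H then ip_norm ip (f - g) else 0)"

lemma mem_add: "f \<in> H \<Longrightarrow> g \<in> H \<Longrightarrow> f + g \<in> H"
  and mem_diff: "f \<in> H \<Longrightarrow> g \<in> H \<Longrightarrow> f - g \<in> H"
  and mem_scale: "f \<in> H \<Longrightarrow> fscale c f \<in> H"
  and mem_zero: "0 \<in> H"
  using subspace
  by (auto intro: fun_vs.subspace_add fun_vs.subspace_diff fun_vs.subspace_scale fun_vs.subspace_0)

lemma ip_add_right: "f \<in> H \<Longrightarrow> g \<in> H \<Longrightarrow> h \<in> H \<Longrightarrow> ip h (f + g) = ip h f + ip h g"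
  by (metis complex_cnj_add ip_add_left ip_cnj mem_add)

lemma ip_scale_right: "f \<in> H \<Longrightarrow> g \<in> H \<Longrightarrow> ip g (fscale c f) = cnj c * ip g f"
  by (metis complex_cnj_mult ip_cnj ip_scale_left mem_scale)

lemma ip_zero: "ip 0 0 = 0"
proof -
  have "ip (0 + 0) 0 = ip 0 0 + ip 0 0"
    by (rule ip_add_left) (rule mem_zero)+
  then show ?thesis by simp
qed

lemma ip_nonneg: "f \<in> H \<Longrightarrow> 0 \<le> Re (ip f f)"
  by (cases "f = 0") (auto simp: ip_zero dest: ip_pos)

lemma Re_ip_le:
  assumes f: "f \<in> H" and g: "g \<in> H"
  shows "Re (ip f g) \<le> ip_norm ip f * ip_norm ip g"
proof (cases "g = 0")
  case True
  have "fscale 0 g = 0" by (simp add: fscale_def fun_eq_iff)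
  then have "ip f g = 0" using True ip_scale_right[OF g f, of 0] by simp
  then show ?thesis using ip_nonneg f g by (simp add: ip_norm_def)
next
  case False
  define a b c where "a = Re (ip f f)" and "b = Re (ip f g)" and "c = Re (ip g g)"
  define t where "t = b / c"
  have c: "0 < c" using ip_pos[OF g False] by (simp add: c_def)
  define u where "u = - t"
  define k where "k = fscale (complex_of_real u) g"
  have k: "k \<in> H" unfolding k_def by (rule mem_scale[OF g])
  have h: "f + k \<in> H" by (rule mem_add[OF f k])
  have fk: "ip f k = of_real u * ip f g" and kk: "ip k k = (of_real u)\<^sup>2 * ip g g"
    using mem_scale[OF g]
    by (simp_all add: k_def ip_scale_right[OF g f] ip_scale_left[OF g]
        ip_scale_right[OF g g] power2_eq_square)
  have "Re (ip (f + k) (f + k)) = Re (ip f f) + 2 * Re (ip f k) + Re (ip k k)"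
    using ip_cnj[OF f k]
    by (simp add: ip_add_left[OF f k h] ip_add_right[OF f k f] ip_add_right[OF f k k])
  also have "\<dots> = a - 2 * t * b + t * t * c"
    by (simp add: fk kk a_def b_def c_def u_def power2_eq_square flip: of_real_mult)
  finally have "Re (ip (f + k) (f + k)) = a - 2 * t * b + t * t * c" .
  with ip_nonneg[OF h] have "0 \<le> a - 2 * t * b + t * t * c" by simp
  also have "\<dots> = a - b\<^sup>2 / c" using c by (simp add: t_def field_simps power2_eq_square)
  finally have "b\<^sup>2 \<le> a * c" using c by (simp add: field_simps)
  then have "b \<le> sqrt (a * c)" by (rule real_le_rsqrt)
  then show ?thesis by (simp add: ip_norm_def a_def b_def c_def real_sqrt_mult)
qed

lemma ip_norm_triangle:
  assumes f: "f \<in> H" and g: "g \<in> H"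
  shows "ip_norm ip (f + g) \<le> ip_norm ip f + ip_norm ip g"
proof -
  have h: "f + g \<in> H" by (rule mem_add[OF f g])
  have nf: "0 \<le> ip_norm ip f" "0 \<le> ip_norm ip g"
    using ip_nonneg f g by (auto simp: ip_norm_def)
  have "Re (ip (f + g) (f + g)) = Re (ip f f) + 2 * Re (ip f g) + Re (ip g g)"
    using ip_cnj[OF f g]
    by (simp add: ip_add_left[OF f g h] ip_add_right[OF f g f] ip_add_right[OF f g g])
  also have "\<dots> \<le> (ip_norm ip f + ip_norm ip g)\<^sup>2"
    using Re_ip_le[OF f g] ip_nonneg[OF f] ip_nonneg[OF g]
    by (simp add: power2_sum) (simp add: ip_norm_def)
  finally show ?thesis using nf unfolding ip_norm_def[of ip "f + g"]
    by (intro real_le_lsqrt) auto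
qed

lemma ip_norm_minus_commute:
  assumes f: "f \<in> H" and g: "g \<in> H"
  shows "ip_norm ip (f - g) = ip_norm ip (g - f)"
proof -
  define d where "d = f - g"
  have d: "d \<in> H" unfolding d_def by (rule mem_diff[OF f g])
  have e: "g - f = fscale (-1) d" by (simp add: d_def fscale_def fun_eq_iff)
  have "ip (g - f) (g - f) = ip d d"
    unfolding e using mem_scale[OF d] by (simp only: ip_scale_left[OF d] ip_scale_right[OF d d]) simp
  then have "ip_norm ip (g - f) = ip_norm ip d" by (simp add: ip_norm_def)
  then show ?thesis by (simp add: d_def)
qed

sublocale metric: Metric_space H ip_dist
proof
  show "0 \<le> ip_dist f g" for f g
    using ip_nonneg mem_diff by (auto simp: ip_dist_def ip_norm_def)
  show "ip_dist f g = ip_dist g f" for f g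
    using ip_norm_minus_commute by (auto simp: ip_dist_def)
  show "ip_dist f g = 0 \<longleftrightarrow> f = g" if "f \<in> H" "g \<in> H" for f g
    using that ip_pos[OF mem_diff[OF that]] ip_zero
    by (cases "f = g") (auto simp: ip_dist_def ip_norm_def)
  show "ip_dist f h \<le> ip_dist f g + ip_dist g h" if "f \<in> H" "g \<in> H" "h \<in> H" for f g h
    using that ip_norm_triangle[of "f - g" "g - h"] mem_diff by (simp add: ip_dist_def)
qed

end

locale rkhs = function_inner_space +
  assumes complete: "metric.mcomplete"
    and eval_continuous: "\<And>x. x \<in> D \<Longrightarrow> continuous_map metric.mtopology euclidean (\<lambda>f. f x)"

definition reproducing_kernel ::
  "'a set \<Rightarrow> ('a \<Rightarrow> complex) set \<Rightarrow> (('a \<Rightarrow> complex) \<Rightarrow> ('a \<Rightarrow> complex) \<Rightarrow> complex)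
    \<Rightarrow> ('a \<Rightarrow> 'a \<Rightarrow> complex) \<Rightarrow> bool" where
  "reproducing_kernel D H ip K \<longleftrightarrow> (\<forall>x\<in>D. K x \<in> H \<and> (\<forall>f\<in>H. ip f (K x) = f x))"

definition orth_compl ::
  "(('a \<Rightarrow> complex) \<Rightarrow> ('a \<Rightarrow> complex) \<Rightarrow> complex) \<Rightarrow> ('a \<Rightarrow> complex) set
    \<Rightarrow> ('a \<Rightarrow> complex) set \<Rightarrow> ('a \<Rightarrow> complex) set" where
  "orth_compl ip H V = {f \<in> H. \<forall>v\<in>V. ip f v = 0}"

definition orth_proj ::
  "(('a \<Rightarrow> complex) \<Rightarrow> ('a \<Rightarrow> complex) \<Rightarrow> complex) \<Rightarrow> ('a \<Rightarrow> complex) set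
    \<Rightarrow> ('a \<Rightarrow> complex) \<Rightarrow> 'a \<Rightarrow> complex" where
  "orth_proj ip V f = (THE g. g \<in> V \<and> (\<forall>v\<in>V. ip (f - g) v = 0))"

definition L2 :: "'a measure \<Rightarrow> ('a \<Rightarrow> complex) set" where
  "L2 M = {f \<in> borel_measurable M. integrable M (\<lambda>x. (cmod (f x))\<^sup>2)}"

definition L2_norm :: "'a measure \<Rightarrow> ('a \<Rightarrow> complex) \<Rightarrow> real" where
  "L2_norm M f = sqrt (LINT x|M. (cmod (f x))\<^sup>2)"

text \<open>The diagonal of a reproducing kernel is real, since \<^term>\<open>K x x = ip (K x) (K x)\<close>.\<close>

definition kernel_trace :: "'a measure \<Rightarrow> ('a \<Rightarrow> 'a \<Rightarrow> complex) \<Rightarrow> real" where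
  "kernel_trace M K = (LINT x|M. Re (K x x))"

end

theory Submission
  imports Defs
begin

text \<open>Everything reduces to finding points $x_i$ and weights $w_i > 0$ such that the discrete energy
$q(f) = \sum_i w_i |f(x_i)|^2$ satisfies two one-sided bounds at once: $q(g) \ge (1-r)^2
\|g\|_2^2$ on $V$ and $q(h) \le (1+s)^2 \lambda \|h\|_H^2$ on the $H$-orthogonal complement of
$V$. Given these, let $p$ be the least squares approximation of $f$, let $y$ be its orthogonal
projection to $V$, and put $h = f - y$. The error $f - p$ is the sum of $h$ and $y - p$. The first
summand is controlled by the definition of $\lambda$, and the second by $(1-r)^2 \|y-p\|_2^2 \le
q(y-p) \le q(h)$, because $p$ is the orthogonal projection with respect to $q$.

The points are found by the barrier method of Batson, Spielman and Srivastava. A space with a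
reproducing kernel $k$ carries for every list of points and weights the operator $A_u f = u f -
\sum_i w_i f(x_i) k_{x_i}$, whose quadratic form is $u\|f\|^2 - q(f)$. If $A_u$ has a positive
symmetric inverse $P$, then $q(f) \le u\|f\|^2$; how far $A_u$ is from degenerate is measured by
the potential $\Phi(P) = \int (P k_x)(x)\,d\mu(x)$, the trace of $P$ times the embedding into
$L_2$. A new point with weight $w$ changes $P$ by the Sherman-Morrison formula
(\<open>resolvent_insert\<close>), so the effect on the potential is explicit.

For the upper bound, the barrier $u$ is raised by a constant $d$ in each step, and a pointwise
condition $U(x) \le 1/w$ ensures that the potential does not exceed its old value
(\<open>upper_step\<close>). For the lower bound, on $V$ with the $L_2$ inner product, the same
operators are used with negated weights, the barrier is lowered, and the condition is $1/w \le
L(x)$ (\<open>lower_step\<close>). The integral of $U$ is at most $n$ and that of $L$ at least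
$n$. Hence there is a point with $U(x) \le L(x)$ and $L(x) > 0$, and $w = 1/L(x)$ serves both
sides (\<open>barriers_select\<close>).

The terms $m-1$ and $\mathrm{Tr}-\lambda$ in place of the usual $m$ and $\mathrm{Tr}$ come from a
careful comparison of the potentials before and after the shift of the barrier: the inequality
$d\,\Phi(P)\Phi(Q) \le \mathrm{Tr}\,(\Phi(P)-\Phi(Q))$ for inverses $P$ of $A_u$ and $Q$ of
$A_{u+d}$ (\<open>potential_pair\<close>). In an eigenbasis it would be the Cauchy-Schwarz
inequality for the eigenvalues; here it follows, like the bounds for the integrals of $U$ and $L$,
from positivity of $P$ and $Q$ at suitable vectors. So the infinite dimension of the complement of
$V$ causes no difficulty.\<close>

section \<open>Orthonormal bases of finite-dimensional inner product spaces\<close>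

context function_inner_space
begin

lemmas mem_simps = mem_add mem_diff mem_scale mem_zero

lemma ip_diff_left: "f \<in> H \<Longrightarrow> g \<in> H \<Longrightarrow> h \<in> H \<Longrightarrow> ip (f - g) h = ip f h - ip g h"
  using ip_add_left[of "f - g" g h] by (simp add: mem_simps)

lemma ip_diff_right: "f \<in> H \<Longrightarrow> g \<in> H \<Longrightarrow> h \<in> H \<Longrightarrow> ip h (f - g) = ip h f - ip h g"
  using ip_add_right[of "f - g" g h] by (simp add: mem_simps)

lemma fscale_0 [simp]: "fscale 0 f = 0"
  by (simp add: fscale_def fun_eq_iff)

lemma ip_zero_left: "f \<in> H \<Longrightarrow> ip 0 f = 0"
  using ip_scale_left[of 0 f 0] by (simp add: mem_simps)

lemma ip_zero_right: "f \<in> H \<Longrightarrow> ip f 0 = 0"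
  using ip_scale_right[of 0 f 0] by (simp add: mem_simps)

lemma ip_self: "f \<in> H \<Longrightarrow> ip f f = complex_of_real (Re (ip f f))"
  using ip_cnj[of f f] by (simp add: complex_eq_iff)

lemma eq_if_ip_diff_0:
  assumes "f \<in> H" "g \<in> H" "\<And>h. h \<in> H \<Longrightarrow> ip f h = ip g h"
  shows "f = g"
  using assms ip_pos[of "f - g"] by (auto simp: ip_diff_left mem_simps)

lemma sum_mem: "(\<And>i. i \<in> I \<Longrightarrow> f i \<in> H) \<Longrightarrow> sum f I \<in> H"
  using subspace by (rule fun_vs.subspace_sum)

lemma ip_sum_left:
  assumes "\<And>i. i \<in> I \<Longrightarrow> f i \<in> H" "g \<in> H"
  shows "ip (sum f I) g = (\<Sum>i\<in>I. ip (f i) g)"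
  using assms
  by (induction I rule: infinite_finite_induct)
    (simp_all add: ip_zero_left ip_add_left sum_mem)

lemma ip_sum_right:
  assumes "\<And>i. i \<in> I \<Longrightarrow> f i \<in> H" "g \<in> H"
  shows "ip g (sum f I) = (\<Sum>i\<in>I. ip g (f i))"
  using assms
  by (induction I rule: infinite_finite_induct)
    (simp_all add: ip_zero_right ip_add_right sum_mem)

definition orthonormal :: "('a \<Rightarrow> complex) set \<Rightarrow> bool" where
  "orthonormal E \<longleftrightarrow> finite E \<and> E \<subseteq> H \<and> (\<forall>e\<in>E. \<forall>e'\<in>E. ip e e' = (if e = e' then 1 else 0))"

text \<open>The coefficients make sense for any function on which the form is defined, also outside
  \<open>H\<close>; least squares approximation applies the expansion to such a function.\<close>

definition expansion :: "('a \<Rightarrow> complex) set \<Rightarrow> ('a \<Rightarrow> complex) \<Rightarrow> 'a \<Rightarrow> complex" where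
  "expansion E f = (\<Sum>e\<in>E. fscale (ip f e) e)"

lemma expansion_mem: "E \<subseteq> H \<Longrightarrow> expansion E f \<in> H"
  unfolding expansion_def by (rule sum_mem) (auto intro: mem_scale)

lemma ip_expansion_left:
  assumes "E \<subseteq> H" "g \<in> H"
  shows "ip (expansion E f) g = (\<Sum>e\<in>E. ip f e * ip e g)"
  unfolding expansion_def using assms
  by (subst ip_sum_left) (auto intro!: sum.cong mem_scale ip_scale_left)

lemma ip_expansion_orthonormal:
  assumes "orthonormal E" "e \<in> E"
  shows "ip (expansion E f) e = ip f e"
proof -
  have "ip (expansion E f) e = (\<Sum>e'\<in>E. ip f e' * ip e' e)"
    using assms by (intro ip_expansion_left) (auto simp: orthonormal_def)
  also have "\<dots> = (\<Sum>e'\<in>E. if e' = e then ip f e else 0)"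
    using assms by (intro sum.cong) (auto simp: orthonormal_def)
  also have "\<dots> = ip f e" using assms by (simp add: orthonormal_def)
  finally show ?thesis .
qed

lemma expansion_add_scale:
  assumes "f \<in> H" "g \<in> H" "E \<subseteq> H"
  shows "expansion E (f + fscale c g) = expansion E f + fscale c (expansion E g)"
proof -
  have "expansion E (f + fscale c g) = (\<Sum>e\<in>E. fscale (ip f e) e + fscale c (fscale (ip g e) e))"
    unfolding expansion_def using assms
    by (intro sum.cong)
      (auto simp: ip_add_left ip_scale_left mem_simps subset_iff fun_vs.scale_left_distrib)
  then show ?thesis
    by (simp add: expansion_def sum.distrib fun_vs.scale_sum_right)
qed

lemma gram_schmidt:
  assumes "finite B" "fun_vs.independent B" "B \<subseteq> H"
  shows "\<exists>E. orthonormal E \<and> E \<subseteq> fun_vs.span B \<and> card E = card B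
    \<and> (\<forall>f\<in>fun_vs.span B. expansion E f = f)"
  using assms
proof (induction B rule: finite_induct)
  case empty
  show ?case by (intro exI[of _ "{}"]) (simp add: orthonormal_def expansion_def)
next
  case (insert b B)
  then have b: "b \<in> H" "b \<notin> fun_vs.span B" and B: "fun_vs.independent B" "B \<subseteq> H"
    by (auto simp: fun_vs.independent_insert)
  then obtain E where E: "orthonormal E" "E \<subseteq> fun_vs.span B" "card E = card B"
    and ex: "\<And>f. f \<in> fun_vs.span B \<Longrightarrow> expansion E f = f"
    using insert.IH by blast
  have EH: "E \<subseteq> H" "finite E" using E by (auto simp: orthonormal_def)
  \<comment> \<open>the Gram-Schmidt step\<close>
  define g where "g = b - expansion E b"
  define N where "N = complex_of_real (sqrt (Re (ip g g)))"
  define e' where "e' = fscale (1 / N) g"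
  have xb: "expansion E b \<in> H" by (rule expansion_mem[OF EH(1)])
  have g: "g \<in> H" unfolding g_def using b xb by (intro mem_diff)
  have "expansion E b \<in> fun_vs.span B"
    unfolding expansion_def using E(2) by (auto intro!: fun_vs.span_sum fun_vs.span_scale)
  with b have g0: "g \<noteq> 0" by (auto simp: g_def)
  have N: "N * N = ip g g" "N \<noteq> 0" "cnj N = N"
    using ip_self[OF g] ip_pos[OF g g0] by (auto simp: N_def simp flip: of_real_mult)
  have e': "e' \<in> H" unfolding e'_def by (rule mem_scale[OF g])
  have gE: "ip g e = 0" if "e \<in> E" for e
    using that ip_expansion_orthonormal[OF E(1) that, of b] b xb EH
    by (auto simp: g_def ip_diff_left)
  have e'E: "ip e' e = 0" "ip e e' = 0" if "e \<in> E" for e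
  proof -
    show *: "ip e' e = 0"
      using that gE[OF that] g EH by (auto simp: e'_def ip_scale_left)
    show "ip e e' = 0" using ip_cnj[OF e', of e] that EH * by auto
  qed
  have ge': "ip g e' = N" using N g by (simp add: e'_def ip_scale_right flip: N(1))
  have e'e': "ip e' e' = 1"
    using N(2) ge' g e' by (simp add: e'_def[symmetric] ip_scale_left[OF g e', of "1/N", folded e'_def])
  have nE: "e' \<notin> E" using e'E(1)[of e'] e'e' by auto
  have ON: "orthonormal (insert e' E)"
    using E(1) e' e'E e'e' by (auto simp: orthonormal_def)
  have be': "ip b e' = N"
  proof -
    have "ip (expansion E b) e' = 0"
      using e'E by (simp add: ip_expansion_left[OF EH(1) e'])
    with ge' show ?thesis using b xb e' by (simp add: g_def ip_diff_left)
  qed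
  have new: "expansion (insert e' E) f = f" if fspan: "f \<in> fun_vs.span (insert b B)" for f
  proof -
    have "\<exists>c. f - fscale c b \<in> fun_vs.span B"
      using fspan by (simp only: fun_vs.span_breakdown_eq)
    then obtain c where c: "f - fscale c b \<in> fun_vs.span B" ..
    define h where "h = f - fscale c b"
    have h: "h \<in> H" unfolding h_def
      using c B(2) fun_vs.span_minimal[OF B(2) subspace] by auto
    have f: "f = h + fscale c b" by (simp add: h_def)
    have "ip h e' = ip (expansion E h) e'" using ex[OF c[folded h_def]] by simp
    also have "\<dots> = 0" using e'E by (simp add: ip_expansion_left[OF EH(1) e'])
    finally have "ip f e' = c * N"
      using be' b e' h by (simp add: f ip_add_left ip_scale_left mem_simps)
    then have "fscale (ip f e') e' = fscale c g" using N(2) by (simp add: e'_def)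
    moreover have "expansion E f = h + fscale c (expansion E b)"
      using ex[OF c[folded h_def]] expansion_add_scale[OF h b(1) EH(1), of c] by (simp add: f)
    ultimately have "expansion (insert e' E) f = h + fscale c (expansion E b) + fscale c g"
      using nE EH(2) by (simp add: expansion_def add.commute)
    also have "\<dots> = h + fscale c b"
      by (simp add: g_def fun_vs.scale_right_diff_distrib)
    finally show ?thesis by (simp add: f)
  qed
  have "insert e' E \<subseteq> fun_vs.span (insert b B)"
  proof -
    have sub: "fun_vs.span B \<subseteq> fun_vs.span (insert b B)" by (rule fun_vs.span_mono) auto
    have "expansion E b \<in> fun_vs.span (insert b B)"
      unfolding expansion_def using E(2) sub by (auto intro!: fun_vs.span_sum fun_vs.span_scale)
    then have "e' \<in> fun_vs.span (insert b B)"
      unfolding e'_def g_def by (intro fun_vs.span_scale fun_vs.span_diff) (auto intro: fun_vs.span_base)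
    then show ?thesis using E(2) sub by blast
  qed
  moreover have "card (insert e' E) = card (insert b B)"
    using E(3) nE EH(2) insert.hyps by simp
  ultimately show ?case using ON new by blast
qed

lemma orthonormal_basis_exists:
  assumes "0 < fun_vs.dim H"
  shows "\<exists>E. orthonormal E \<and> card E = fun_vs.dim H \<and> (\<forall>f\<in>H. expansion E f = f)"
proof -
  obtain B where B: "B \<subseteq> H" "fun_vs.independent B" "H \<subseteq> fun_vs.span B" "card B = fun_vs.dim H"
    using fun_vs.basis_exists[of H] by auto
  have "finite B" using B(4) assms by (metis card.infinite less_irrefl)
  then obtain E where "orthonormal E" "card E = card B" "\<forall>f\<in>fun_vs.span B. expansion E f = f"
    using gram_schmidt[OF _ B(2,1)] by auto
  with B(3,4) show ?thesis by auto
qed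

end

section \<open>Resolvents of sampling operators\<close>

definition sample_energy :: "(real \<times> 'a) list \<Rightarrow> ('a \<Rightarrow> complex) \<Rightarrow> real" where
  "sample_energy l f = (\<Sum>(w, x)\<leftarrow>l. w * (cmod (f x))\<^sup>2)"

locale kernel_space = function_inner_space "space M" S ip
  for M :: "'a measure" and S :: "('a \<Rightarrow> complex) set" and ip +
  fixes k :: "'a \<Rightarrow> 'a \<Rightarrow> complex"
  assumes reproducing: "reproducing_kernel (space M) S ip k"
    and square_integrable: "S \<subseteq> L2 M"
    and diagonal_integrable: "integrable M (\<lambda>x. Re (k x x))"
begin

lemma kernel_mem: "x \<in> space M \<Longrightarrow> k x \<in> S"
  and ip_kernel: "x \<in> space M \<Longrightarrow> f \<in> S \<Longrightarrow> ip f (k x) = f x"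
  using reproducing by (auto simp: reproducing_kernel_def)

lemma ip_kernel_left: "x \<in> space M \<Longrightarrow> f \<in> S \<Longrightarrow> ip (k x) f = cnj (f x)"
  using ip_cnj[of f "k x"] by (simp add: ip_kernel kernel_mem)

text \<open>The resolvent estimates only use the real part of the inner product, which is a symmetric
  real bilinear form; passing to it removes all conjugates from the calculations.\<close>

definition rip :: "('a \<Rightarrow> complex) \<Rightarrow> ('a \<Rightarrow> complex) \<Rightarrow> real" where
  "rip f g = Re (ip f g)"

definition rscale :: "real \<Rightarrow> ('a \<Rightarrow> complex) \<Rightarrow> 'a \<Rightarrow> complex" where
  "rscale c = fscale (complex_of_real c)"

lemma rscale_mem: "f \<in> S \<Longrightarrow> rscale c f \<in> S"
  by (simp add: rscale_def mem_scale)

lemma rip_add_diff: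
  assumes "f \<in> S" "g \<in> S" "h \<in> S"
  shows "rip (f + g) h = rip f h + rip g h" "rip h (f + g) = rip h f + rip h g"
    "rip (f - g) h = rip f h - rip g h" "rip h (f - g) = rip h f - rip h g"
  using assms
  by (simp_all add: rip_def ip_add_left ip_add_right ip_diff_left ip_diff_right)

lemma rip_rscale:
  assumes "f \<in> S" "g \<in> S"
  shows "rip (rscale c f) g = c * rip f g" "rip f (rscale c g) = c * rip f g"
  using assms by (simp_all add: rip_def rscale_def ip_scale_left ip_scale_right)

lemma rip_commute: "f \<in> S \<Longrightarrow> g \<in> S \<Longrightarrow> rip f g = rip g f"
  using ip_cnj[of f g] by (simp add: rip_def)

lemma rip_nonneg: "f \<in> S \<Longrightarrow> 0 \<le> rip f f"
  unfolding rip_def by (rule ip_nonneg)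

lemma rip_pos: "f \<in> S \<Longrightarrow> f \<noteq> 0 \<Longrightarrow> 0 < rip f f"
  unfolding rip_def by (rule ip_pos)

lemma rip_ip_norm: "f \<in> S \<Longrightarrow> (ip_norm ip f)\<^sup>2 = rip f f"
  using rip_nonneg[of f] by (simp add: ip_norm_def rip_def)

text \<open>The operator whose quadratic form is the sample energy. Weights may have any sign: positive
  ones serve the upper barrier, negative ones the lower barrier.\<close>

primrec sample_op :: "(real \<times> 'a) list \<Rightarrow> ('a \<Rightarrow> complex) \<Rightarrow> 'a \<Rightarrow> complex" where
  "sample_op [] f = 0"
| "sample_op (p # l) f = fscale (of_real (fst p) * f (snd p)) (k (snd p)) + sample_op l f"

definition shifted :: "real \<Rightarrow> (real \<times> 'a) list \<Rightarrow> ('a \<Rightarrow> complex) \<Rightarrow> 'a \<Rightarrow> complex" where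
  "shifted u l f = rscale u f - sample_op l f"

definition admissible :: "(real \<times> 'a) list \<Rightarrow> bool" where
  "admissible l \<longleftrightarrow> snd ` set l \<subseteq> space M"

lemma admissible_simps [simp]: "admissible []" 
  "admissible (p # l) \<longleftrightarrow> snd p \<in> space M \<and> admissible l"
  by (auto simp: admissible_def)

lemma sample_op_mem: "admissible l \<Longrightarrow> f \<in> S \<Longrightarrow> sample_op l f \<in> S"
  by (induction l) (auto intro!: mem_simps kernel_mem)

lemma shifted_mem: "admissible l \<Longrightarrow> f \<in> S \<Longrightarrow> shifted u l f \<in> S"
  unfolding shifted_def by (intro mem_diff rscale_mem sample_op_mem)

lemma ip_sample_op:
  "admissible l \<Longrightarrow> f \<in> S \<Longrightarrow> g \<in> S \<Longrightarrow>
    ip (sample_op l f) g = (\<Sum>(w, x)\<leftarrow>l. of_real w * f x * cnj (g x))"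
  by (induction l)
    (auto simp: ip_zero_left ip_add_left mem_simps kernel_mem sample_op_mem ip_scale_left
      ip_kernel_left)

lemma ip_shifted:
  "admissible l \<Longrightarrow> f \<in> S \<Longrightarrow> g \<in> S \<Longrightarrow>
    ip (shifted u l f) g = of_real u * ip f g - (\<Sum>(w, x)\<leftarrow>l. of_real w * f x * cnj (g x))"
  by (simp add: shifted_def ip_diff_left rscale_mem sample_op_mem ip_sample_op)
    (simp add: rscale_def ip_scale_left)

lemma ip_shifted_swap:
  assumes "admissible l" "f \<in> S" "g \<in> S"
  shows "ip (shifted u l f) g = ip f (shifted u l g)"
proof -
  have *: "cnj (\<Sum>(w, x)\<leftarrow>l. of_real w * g x * cnj (f x)) = (\<Sum>(w, x)\<leftarrow>l. of_real w * f x * cnj (g x))"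
    by (induction l) (auto simp: algebra_simps)
  have "ip f (shifted u l g) = cnj (ip (shifted u l g) f)"
    using assms by (intro ip_cnj shifted_mem)
  then show ?thesis
    using assms * ip_cnj[of g f] by (simp add: ip_shifted)
qed

lemma rip_shifted:
  assumes "admissible l" "f \<in> S"
  shows "rip (shifted u l f) f = u * rip f f - sample_energy l f"
proof -
  have "Re (\<Sum>(w, x)\<leftarrow>l. of_real w * f x * cnj (f x)) = sample_energy l f"
    unfolding sample_energy_def
    by (induction l)
      (auto simp: cmod_power2 algebra_simps, simp add: power2_eq_square algebra_simps)
  then show ?thesis using assms by (simp add: rip_def ip_shifted)
qed

lemma shifted_add: 
  "shifted u l (f + g) = shifted u l f + shifted u l g"
proof -
  have "sample_op l (f + g) = sample_op l f + sample_op l g"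
    by (induction l) (auto simp: fun_eq_iff fscale_def algebra_simps)
  then show ?thesis
    by (simp add: shifted_def rscale_def fun_vs.scale_right_distrib)
qed

lemma shifted_scale: "shifted u l (fscale c f) = fscale c (shifted u l f)"
proof -
  have "sample_op l (fscale c f) = fscale c (sample_op l f)"
    by (induction l) (auto simp: fun_eq_iff fscale_def algebra_simps)
  then show ?thesis
    by (simp add: shifted_def rscale_def fscale_def fun_eq_iff algebra_simps)
qed

lemma shifted_plus: "shifted (u + d) l f = shifted u l f + rscale d f"
  by (simp add: shifted_def rscale_def fscale_def fun_eq_iff algebra_simps)

lemma shifted_Cons:
  "shifted u (p # l) f = shifted u l f - fscale (of_real (fst p) * f (snd p)) (k (snd p))"
  by (simp add: shifted_def fun_eq_iff)

text \<open>The diagonal of the kernel $\langle P k_x, k_y\rangle$, and its integral. The latter is the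
  trace of $P$ times the operator $\int k_x \otimes k_x\,d\mu$ of the embedding into $L_2$.\<close>

definition diag :: "(('a \<Rightarrow> complex) \<Rightarrow> 'a \<Rightarrow> complex) \<Rightarrow> 'a \<Rightarrow> real" where
  "diag P x = Re (P (k x) x)"

definition potential :: "(('a \<Rightarrow> complex) \<Rightarrow> 'a \<Rightarrow> complex) \<Rightarrow> real" where
  "potential P = (LINT x|M. diag P x)"

text \<open>Only a right inverse is demanded; by symmetry it is also a left inverse, hence linear
  (\<open>resolvent_shifted\<close>, \<open>resolvent_add\<close>). Integrability of the diagonal is included because it
  is inherited along the construction of the inverses. Measurability of $x \mapsto \|P k_x\|$
  is never an issue: the functions that bound the admissible weights are combinations of such
  diagonals.\<close>

definition resolvent :: "real \<Rightarrow> (real \<times> 'a) list \<Rightarrow> (('a \<Rightarrow> complex) \<Rightarrow> 'a \<Rightarrow> complex) \<Rightarrow> bool" where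
  "resolvent u l P \<longleftrightarrow> admissible l \<and> (\<forall>f\<in>S. P f \<in> S)
    \<and> (\<forall>f\<in>S. \<forall>g\<in>S. ip (P f) g = ip f (P g)) \<and> (\<forall>f\<in>S. 0 \<le> rip (P f) f)
    \<and> (\<forall>f\<in>S. shifted u l (P f) = f) \<and> integrable M (diag P)"

lemma
  assumes "resolvent u l P"
  shows resolvent_admissible: "admissible l"
    and resolvent_mem: "f \<in> S \<Longrightarrow> P f \<in> S"
    and resolvent_swap: "f \<in> S \<Longrightarrow> g \<in> S \<Longrightarrow> ip (P f) g = ip f (P g)"
    and resolvent_nonneg: "f \<in> S \<Longrightarrow> 0 \<le> rip (P f) f"
    and shifted_resolvent: "f \<in> S \<Longrightarrow> shifted u l (P f) = f"
    and resolvent_integrable: "integrable M (diag P)"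
  using assms by (simp_all add: resolvent_def)

lemma resolvent_rip_swap: 
  "resolvent u l P \<Longrightarrow> f \<in> S \<Longrightarrow> g \<in> S \<Longrightarrow> rip (P f) g = rip f (P g)"
  by (simp add: rip_def resolvent_swap)

lemma resolvent_shifted:
  assumes P: "resolvent u l P" and f: "f \<in> S"
  shows "P (shifted u l f) = f"
proof (rule eq_if_ip_diff_0)
  note adm = resolvent_admissible[OF P]
  show "P (shifted u l f) \<in> S" "f \<in> S" 
    using f by (auto intro!: resolvent_mem[OF P] shifted_mem adm)
  show "ip (P (shifted u l f)) h = ip f h" if "h \<in> S" for h
    using that f adm
    by (simp add: resolvent_swap[OF P] resolvent_mem[OF P] shifted_mem ip_shifted_swap
        shifted_resolvent[OF P])
qed

lemma resolvent_add:
  assumes P: "resolvent u l P" and "f \<in> S" "g \<in> S"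
  shows "P (f + g) = P f + P g"
proof -
  have "P (shifted u l (P f + P g)) = P f + P g"
    using assms by (intro resolvent_shifted mem_add resolvent_mem[OF P])
  then show ?thesis using assms by (simp add: shifted_add shifted_resolvent[OF P])
qed

lemma resolvent_scale:
  assumes P: "resolvent u l P" and "f \<in> S"
  shows "P (fscale c f) = fscale c (P f)"
proof -
  have "P (shifted u l (fscale c (P f))) = fscale c (P f)"
    using assms by (intro resolvent_shifted mem_scale resolvent_mem[OF P])
  then show ?thesis using assms by (simp add: shifted_scale shifted_resolvent[OF P])
qed

lemma resolvent_diff:
  assumes P: "resolvent u l P" and "f \<in> S" "g \<in> S"
  shows "P (f - g) = P f - P g"
  using resolvent_add[OF P, of "f - g" g] assms by (simp add: mem_simps)

lemma resolvent_rscale: "resolvent u l P \<Longrightarrow> f \<in> S \<Longrightarrow> P (rscale c f) = rscale c (P f)"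
  unfolding rscale_def by (rule resolvent_scale)

lemma resolvent_unscaled: "0 < u \<Longrightarrow> resolvent u [] (rscale (1 / u))"
proof -
  assume u: "0 < u"
  have "diag (rscale (1 / u)) = (\<lambda>x. 1 / u * Re (k x x))"
    by (simp add: diag_def rscale_def fscale_def fun_eq_iff)
  then have "integrable M (diag (rscale (1 / u)))" using diagonal_integrable by simp
  moreover have "shifted u [] (rscale (1 / u) f) = f" for f
    using u by (simp add: shifted_def rscale_def)
  ultimately show ?thesis using u
    by (auto simp: resolvent_def rscale_mem rip_rscale rip_nonneg)
      (simp add: rscale_def ip_scale_left ip_scale_right)
qed

lemma potential_unscaled: "potential (rscale (1 / u)) = kernel_trace M k / u"
  by (simp add: potential_def diag_def rscale_def fscale_def kernel_trace_def)

lemma diag_eq_rip: 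
  "resolvent u l P \<Longrightarrow> x \<in> space M \<Longrightarrow> diag P x = rip (P (k x)) (k x)"
  by (simp add: diag_def rip_def ip_kernel kernel_mem resolvent_mem)

lemma diag_nonneg: "resolvent u l P \<Longrightarrow> x \<in> space M \<Longrightarrow> 0 \<le> diag P x"
  by (simp add: diag_eq_rip resolvent_nonneg kernel_mem)

lemma potential_nonneg: "resolvent u l P \<Longrightarrow> 0 \<le> potential P"
  unfolding potential_def by (rule Bochner_Integration.integral_nonneg) (rule diag_nonneg)

text \<open>The form $\langle P f, g\rangle$ is positive semidefinite. Testing it at $f + t z g$ with
  $z = \langle P f, g\rangle$ and real $t$ gives a quadratic polynomial in $t$ without negative
  values, which forces the inequality.\<close>

lemma resolvent_cauchy_schwarz:
  assumes P: "resolvent u l P" and f: "f \<in> S" and g: "g \<in> S"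
  shows "(cmod (ip (P f) g))\<^sup>2 \<le> rip (P f) f * rip (P g) g"
proof -
  define z where "z = ip (P f) g"
  define a b c where "a = rip (P f) f" and "b = (cmod z)\<^sup>2" and "c = rip (P g) g"
  have key: "0 \<le> a + 2 * t * b + t\<^sup>2 * b * c" for t
  proof -
    define y where "y = of_real t * z"
    define h where "h = fscale y g"
    have h: "h \<in> S" and Ph: "P h = fscale y (P g)" 
      using g by (simp_all add: h_def mem_scale resolvent_scale[OF P])
    have "rip (P f) h = t * b"
      using f g by (simp add: rip_def h_def ip_scale_right resolvent_mem[OF P] y_def b_def
          flip: z_def) (simp only: cmod_power2, simp add: power2_eq_square algebra_simps)
    moreover have "rip (P h) f = rip (P f) h"
      using f h rip_commute[of f "P h"] by (simp add: resolvent_rip_swap[OF P] resolvent_mem[OF P])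
    moreover have "rip (P h) h = t\<^sup>2 * b * c"
    proof -
      have "ip (P h) h = y * cnj y * ip (P g) g"
        using g h by (simp add: Ph ip_scale_left resolvent_mem[OF P])
          (simp add: h_def ip_scale_right resolvent_mem[OF P] g)
      also have "y * cnj y = of_real ((cmod y)\<^sup>2)"
        by (rule complex_norm_square[symmetric])
      also have "(cmod y)\<^sup>2 = t\<^sup>2 * b"
        by (simp add: y_def b_def norm_mult power_mult_distrib)
      finally show ?thesis by (simp add: rip_def c_def)
    qed
    moreover have "0 \<le> rip (P (f + h)) (f + h)"
      using f h by (intro resolvent_nonneg[OF P] mem_add)
    ultimately show ?thesis using f h
      by (simp add: resolvent_add[OF P] rip_add_diff mem_add resolvent_mem[OF P] a_def ac_simps)
  qed
  have "a \<ge> 0" "c \<ge> 0" "b \<ge> 0" using f g by (simp_all add: a_def b_def c_def resolvent_nonneg[OF P])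
  have "b \<le> a * c"
  proof (cases "c = 0")
    case True
    show ?thesis
    proof (rule ccontr)
      assume "\<not> b \<le> a * c"
      with True \<open>b \<ge> 0\<close> have "b > 0" by simp
      \<comment> \<open>the polynomial is linear here and takes the value $-1$ at this point\<close>
      with key[of "- (a + 1) / (2 * b)"] True show False by (simp add: field_simps)
    qed
  next
    case False
    with \<open>c \<ge> 0\<close> have "c > 0" by simp
    with key[of "- 1 / c"] show ?thesis by (simp add: field_simps power2_eq_square)
  qed
  then show ?thesis by (simp add: a_def b_def c_def z_def)
qed

lemma L2_mem: "f \<in> S \<Longrightarrow> integrable M (\<lambda>x. (cmod (f x))\<^sup>2)"
  using square_integrable by (auto simp: L2_def)

lemma L2_norm_power2: "(L2_norm M f)\<^sup>2 = (LINT x|M. (cmod (f x))\<^sup>2)"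
  unfolding L2_norm_def by (subst real_sqrt_pow2) auto

text \<open>The operator bound $\|P\| \le \mathrm{tr}\,P$ in disguise: apply Cauchy-Schwarz with
  $g = k_x$ and integrate over $x$.\<close>

lemma L2_norm_resolvent_le:
  assumes P: "resolvent u l P" and f: "f \<in> S"
  shows "(L2_norm M (P f))\<^sup>2 \<le> rip (P f) f * potential P"
proof -
  have "(LINT x|M. (cmod (P f x))\<^sup>2) \<le> (LINT x|M. rip (P f) f * diag P x)"
  proof (rule integral_mono)
    show "(cmod (P f x))\<^sup>2 \<le> rip (P f) f * diag P x" if "x \<in> space M" for x
      using resolvent_cauchy_schwarz[OF P f kernel_mem[OF that]] that f
      by (simp add: ip_kernel resolvent_mem[OF P] diag_eq_rip[OF P])
  qed (use P f in \<open>auto intro: L2_mem resolvent_mem resolvent_integrable\<close>)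
  then show ?thesis by (simp add: L2_norm_power2 potential_def)
qed

text \<open>A small potential keeps the form of $A_u$ away from zero. The lower barrier needs this twice:
  it leaves room for the next shift, and at the end it compensates for the starting value of the
  barrier.\<close>

lemma L2_norm_le_shifted:
  assumes P: "resolvent u l P" and f: "f \<in> S"
  shows "(L2_norm M f)\<^sup>2 \<le> (u * rip f f - sample_energy l f) * potential P"
  using L2_norm_resolvent_le[OF P, of "shifted u l f"] f resolvent_admissible[OF P]
  by (simp add: resolvent_shifted[OF P] shifted_mem rip_shifted[symmetric] rip_commute[of f "shifted u l f"])

lemma sample_energy_le:
  assumes P: "resolvent u l P" and f: "f \<in> S"
  shows "sample_energy l f \<le> u * rip f f"
  using resolvent_nonneg[OF P, of "shifted u l f"] f resolvent_admissible[OF P]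
  by (simp add: resolvent_shifted[OF P] shifted_mem rip_shifted rip_commute[of f "shifted u l f"])

end

section \<open>Adding a point and shifting the barrier\<close>

context kernel_space
begin

text \<open>The Sherman-Morrison formula. The condition $w \langle P k_z, k_z\rangle < 1$ says that the
  rank one perturbation does not push the form of $A_u$ to zero. For negative weights it is
  automatic, but then positivity of the new inverse needs Cauchy-Schwarz for $P$.\<close>

lemma resolvent_insert:
  assumes P: "resolvent u l P" and z: "z \<in> space M" and w: "w * diag P z < 1"
  defines "c \<equiv> w / (1 - w * diag P z)"
  defines "P' \<equiv> \<lambda>f. P f + fscale (of_real c * P f z) (P (k z))"
  shows "resolvent u ((w, z) # l) P'"
    and "potential P' = potential P + c * (L2_norm M (P (k z)))\<^sup>2"
proof -
  define d where "d = diag P z"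
  note [simp] = resolvent_mem[OF P] kernel_mem[OF z] mem_simps
  have kz: "P f z = ip (P f) (k z)" if "f \<in> S" for f
    using that z by (simp add: ip_kernel)
  have Pkz: "P (k z) z = of_real d"
  proof -
    have "ip (P (k z)) (k z) = cnj (ip (P (k z)) (k z))"
      using ip_cnj[of "k z" "P (k z)"] by (simp add: resolvent_swap[OF P])
    then have "P (k z) z = cnj (P (k z) z)" by (simp add: kz)
    then show ?thesis by (simp add: d_def diag_def complex_eq_iff)
  qed
  have cd: "c = w * (1 + c * d)" using w by (simp add: c_def d_def field_simps)
  have ipPk: "ip (P (k z)) g = cnj (P g z)" "ip g (P (k z)) = P g z" if "g \<in> S" for g
    using that z by (simp_all add: resolvent_swap[OF P] ip_kernel_left)
      (simp add: ip_kernel flip: resolvent_swap[OF P])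
  have diagP': "diag P' x = diag P x + c * (cmod (P (k z) x))\<^sup>2" if x: "x \<in> space M" for x
  proof -
    have "P (k x) z = cnj (P (k z) x)"
      using x ipPk(2)[of "k x"] kernel_mem[OF x] by (simp add: ip_kernel_left)
    then show ?thesis
      by (simp add: diag_def P'_def fscale_def cmod_power2)
        (simp add: power2_eq_square algebra_simps)
  qed
  have int: "integrable M (\<lambda>x. diag P x + c * (cmod (P (k z) x))\<^sup>2)"
    by (intro Bochner_Integration.integrable_add integrable_mult_right resolvent_integrable[OF P]
        L2_mem) simp
  show "resolvent u ((w, z) # l) P'"
    unfolding resolvent_def
  proof (intro conjI ballI)
    show "admissible ((w, z) # l)" using z resolvent_admissible[OF P] by simp
    show "integrable M (diag P')"
      using int diagP' by (subst Bochner_Integration.integrable_cong) auto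
  next
    fix f assume f: "f \<in> S"
    then show P'f: "P' f \<in> S" by (simp add: P'_def)
    show "shifted u ((w, z) # l) (P' f) = f"
    proof -
      have "shifted u l (P' f) = f + fscale (of_real c * P f z) (k z)"
        using f by (simp add: P'_def shifted_add shifted_scale shifted_resolvent[OF P])
      moreover have "of_real w * P' f z = of_real c * P f z"
      proof -
        have "of_real w * P' f z = of_real (w * (1 + c * d)) * P f z"
          by (simp add: P'_def fscale_def Pkz algebra_simps)
        then show ?thesis by (simp flip: cd)
      qed
      ultimately show ?thesis by (simp add: shifted_Cons)
    qed
    show "0 \<le> rip (P' f) f"
    proof -
      define A b where "A = rip (P f) f" and "b = (cmod (P f z))\<^sup>2"
      have "rip (P' f) f = A + c * b"
        using f by (simp add: P'_def rip_def ip_add_left ip_scale_left ipPk A_def b_def cmod_power2)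
          (simp add: power2_eq_square algebra_simps)
      moreover have "0 \<le> A" "0 \<le> b" "0 \<le> d" "b \<le> A * d"
        using resolvent_nonneg[OF P f] diag_nonneg[OF P z] resolvent_cauchy_schwarz[OF P f, of "k z"] f z
        by (simp_all add: A_def b_def d_def ip_kernel diag_eq_rip[OF P])
      moreover have "0 \<le> A + c * b"
      proof (cases "0 \<le> w")
        case True
        then have "0 \<le> c" using w by (simp add: c_def)
        then show ?thesis using \<open>0 \<le> A\<close> \<open>0 \<le> b\<close> by simp
      next
        case False
        then have "c \<le> 0" using w by (simp add: c_def divide_le_0_iff)
        then have "c * (A * d) \<le> c * b" using \<open>b \<le> A * d\<close> by (intro mult_left_mono_neg)
        moreover have "0 \<le> 1 + c * d"
          using w by (simp add: c_def d_def field_simps)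
        then have "0 \<le> A * (1 + c * d)" using \<open>0 \<le> A\<close> by simp
        ultimately show ?thesis by (simp add: algebra_simps)
      qed
      ultimately show ?thesis by simp
    qed
    fix g assume g: "g \<in> S"
    show "ip (P' f) g = ip f (P' g)"
      using f g by (simp add: P'_def ip_add_left ip_add_right ip_scale_left ip_scale_right ipPk)
        (simp add: resolvent_swap[OF P])
  qed
  have "potential P' = (LINT x|M. diag P x + c * (cmod (P (k z) x))\<^sup>2)"
    unfolding potential_def by (rule Bochner_Integration.integral_cong) (auto simp: diagP')
  also have "\<dots> = potential P + c * (L2_norm M (P (k z)))\<^sup>2"
    unfolding potential_def L2_norm_power2
    by (subst Bochner_Integration.integral_add)
      (auto intro!: integrable_mult_right resolvent_integrable[OF P] L2_mem)
  finally show "potential P' = potential P + c * (L2_norm M (P (k z)))\<^sup>2" .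
qed

text \<open>Below, $P$ and $Q$ are inverses at the barriers $u$ and $u+d$ for the same samples. They
  satisfy the resolvent identity $P - Q = d\,PQ = d\,QP$.\<close>

context
  fixes u d l P Q
  assumes P: "resolvent u l P" and Q: "resolvent (u + d) l Q"
begin

lemma resolvent_identity:
  assumes f: "f \<in> S"
  shows "rscale d (P (Q f)) = P f - Q f" "rscale d (Q (P f)) = P f - Q f"
proof -
  have "P f = P (shifted u l (Q f) + rscale d (Q f))"
    using shifted_resolvent[OF Q f] by (simp add: shifted_plus)
  also have "\<dots> = Q f + rscale d (P (Q f))"
    using f resolvent_admissible[OF P]
    by (simp add: resolvent_add[OF P] shifted_mem resolvent_mem[OF Q] rscale_mem
        resolvent_shifted[OF P] resolvent_rscale[OF P])
  finally show "rscale d (P (Q f)) = P f - Q f" by simp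
  have "Q f = Q (shifted (u + d) l (P f) - rscale d (P f))"
    using shifted_resolvent[OF P f] by (simp add: shifted_plus)
  also have "\<dots> = P f - rscale d (Q (P f))"
    using f resolvent_admissible[OF P]
    by (simp add: resolvent_diff[OF Q] shifted_mem resolvent_mem[OF P] rscale_mem
        resolvent_shifted[OF Q] resolvent_rscale[OF Q])
  finally show "rscale d (Q (P f)) = P f - Q f" by (simp add: algebra_simps)
qed

lemma resolvent_difference:
  assumes f: "f \<in> S"
  shows "d * rip (P f) (Q f) = rip (P f) f - rip (Q f) f"
proof -
  have "d * rip (P f) (Q f) = rip (rscale d (Q (P f))) f"
    using f by (simp add: rip_add_diff rip_rscale resolvent_mem[OF P] resolvent_mem[OF Q] resolvent_rip_swap[OF Q])
  then show ?thesis
    using f by (simp add: resolvent_identity rip_add_diff rip_rscale resolvent_mem[OF P] resolvent_mem[OF Q])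
qed

text \<open>Both bounds express positivity of $P$ at $g = (1-c) f - d\,Q f$: the first is
  $\langle P g, g\rangle \ge 0$, the second $\|g\|^2 + d \langle P g, g\rangle \ge 0$. In terms
  of the commuting operator $Y = 1 - d\,Q$ with $Y^{-1} = 1 + d\,P$, one has $g = (Y - c) f$, and
  the second bound is $\langle Y^{-1}(Y-c)f, (Y-c)f\rangle \ge 0$, the pointwise form of a
  Cauchy-Schwarz inequality between $Y$ and $Y^{-1}$.\<close>

lemma upper_pair_bounds:
  assumes f: "f \<in> S" and d: "0 < d"
  shows "d * rip (Q f) (Q f) \<le> c\<^sup>2 * rip (P f) f + (1 - 2 * c) * rip (Q f) f"
    and "0 \<le> (1 - c)\<^sup>2 * rip f f - d * rip (Q f) f + c\<^sup>2 * d * rip (P f) f"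
proof -
  note [simp] = f resolvent_mem[OF P] resolvent_mem[OF Q] rscale_mem mem_simps
  define g where "g = rscale (1 - c) f - rscale d (Q f)"
  have g: "g \<in> S" by (simp add: g_def)
  have Pg: "P g = rscale (1 - c) (P f) - (P f - Q f)"
    by (simp add: g_def resolvent_diff[OF P] resolvent_rscale[OF P] resolvent_identity)
  have comm: "rip f (Q f) = rip (Q f) f" "rip (Q f) (P f) = rip (P f) (Q f)"
    by (simp_all add: rip_commute)
  define a b N x where "a = rip (P f) f" and "b = rip (Q f) f" and "N = rip (Q f) (Q f)"
    and "x = rip (P f) (Q f)"
  have dx: "d * x = a - b" using resolvent_difference[OF f] by (simp add: a_def b_def x_def)
  have "rip (P g) g = (1 - c) * ((1 - c) * a - d * x) - ((1 - c) * a - d * x) + ((1 - c) * b - d * N)"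
    by (simp add: Pg) (simp add: g_def rip_add_diff rip_rscale a_def b_def N_def x_def algebra_simps)
  also have "\<dots> = c\<^sup>2 * a + (1 - 2 * c) * b - d * N"
    unfolding dx by (simp add: power2_eq_square algebra_simps)
  finally have Pgg: "rip (P g) g = c\<^sup>2 * a + (1 - 2 * c) * b - d * N" .
  have pos: "0 \<le> rip (P g) g" by (rule resolvent_nonneg[OF P g])
  with Pgg show "d * rip (Q f) (Q f) \<le> c\<^sup>2 * rip (P f) f + (1 - 2 * c) * rip (Q f) f"
    by (simp add: a_def b_def N_def)
  have "rip g g = (1 - c)\<^sup>2 * rip f f - 2 * (1 - c) * d * b + d\<^sup>2 * N"
    by (simp add: g_def rip_add_diff rip_rscale comm b_def N_def power2_eq_square algebra_simps)
  moreover have "0 \<le> rip g g + d * rip (P g) g"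
    using pos d rip_nonneg[OF g] by simp
  ultimately have "0 \<le> (1 - c)\<^sup>2 * rip f f - d * b + c\<^sup>2 * d * a"
    by (simp add: Pgg power2_eq_square algebra_simps)
  then show "0 \<le> (1 - c)\<^sup>2 * rip f f - d * rip (Q f) f + c\<^sup>2 * d * rip (P f) f"
    by (simp add: a_def b_def)
qed

text \<open>Positivity of $Q$ at $d\,P f - t f$. Integrated and optimized over $t$ it becomes a
  Cauchy-Schwarz inequality between traces of $Q$, $PQ$ and $P^2 Q$.\<close>

lemma lower_pair_bound:
  assumes f: "f \<in> S"
  shows "(1 + 2 * t) * rip (P f) f - (1 + t)\<^sup>2 * rip (Q f) f \<le> d * rip (P f) (P f)"
proof -
  note [simp] = f resolvent_mem[OF P] resolvent_mem[OF Q] rscale_mem mem_simps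
  define g where "g = rscale d (P f) - rscale t f"
  have g: "g \<in> S" by (simp add: g_def)
  have Qg: "Q g = (P f - Q f) - rscale t (Q f)"
    by (simp add: g_def resolvent_diff[OF Q] resolvent_rscale[OF Q] resolvent_identity)
  have comm: "rip (Q f) (P f) = rip (P f) (Q f)"
    by (simp add: rip_commute)
  define a b N x where "a = rip (P f) f" and "b = rip (Q f) f" and "N = rip (P f) (P f)"
    and "x = rip (P f) (Q f)"
  have dx: "d * x = a - b" using resolvent_difference[OF f] by (simp add: a_def b_def x_def)
  have "rip (Q g) g = d * N - t * a - (1 + t) * (d * x) + t * (1 + t) * b"
    by (simp add: Qg) (simp add: g_def rip_add_diff rip_rscale comm a_def b_def N_def x_def algebra_simps)
  also have "\<dots> = d * N - ((1 + 2 * t) * a - (1 + t)\<^sup>2 * b)"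
    unfolding dx by (simp add: power2_eq_square algebra_simps)
  finally show ?thesis using resolvent_nonneg[OF Q g] by (simp add: a_def b_def N_def)
qed

end

abbreviation Tr :: real where
  "Tr \<equiv> kernel_trace M k"

lemma rip_kernel: "x \<in> space M \<Longrightarrow> rip (k x) (k x) = Re (k x x)"
  by (simp add: rip_def ip_kernel kernel_mem)

text \<open>The Cauchy-Schwarz inequality
  $(\mathrm{tr}\,1)^2 \le \mathrm{tr}\,Y\;\mathrm{tr}\,Y^{-1}$ for $Y = 1 - d\,Q$, where traces are
  weighted by the embedding into $L_2$.\<close>

lemma potential_pair:
  assumes P: "resolvent u l P" and Q: "resolvent (u + d) l Q" and d: "0 < d" and T: "0 < Tr"
  shows "d * potential P * potential Q \<le> Tr * (potential P - potential Q)"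
proof -
  have pP: "0 \<le> potential P" by (rule potential_nonneg[OF P])
  have pos: "0 < Tr + d * potential P" using T pP d by (simp add: add_pos_nonneg)
  \<comment> \<open>the minimizer over $c$ of the right-hand side of the integrated bound\<close>
  define c where "c = Tr / (Tr + d * potential P)"
  have "0 \<le> (LINT x|M. (1 - c)\<^sup>2 * Re (k x x) - d * diag Q x + c\<^sup>2 * d * diag P x)"
    using upper_pair_bounds(2)[OF P Q kernel_mem d]
    by (intro Bochner_Integration.integral_nonneg) (simp add: rip_kernel diag_eq_rip[OF P] diag_eq_rip[OF Q])
  also have "\<dots> = (1 - c)\<^sup>2 * Tr - d * potential Q + c\<^sup>2 * d * potential P"
    unfolding kernel_trace_def potential_def
    by (simp add: diagonal_integrable resolvent_integrable[OF P] resolvent_integrable[OF Q])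
  finally have "d * potential Q \<le> (1 - c)\<^sup>2 * Tr + c\<^sup>2 * d * potential P" by simp
  also have "\<dots> = c * d * potential P"
  proof -
    have c: "(1 - c) * Tr = c * d * potential P"
      using pos by (simp add: c_def field_simps)
    have "(1 - c)\<^sup>2 * Tr = (1 - c) * ((1 - c) * Tr)" by (simp add: power2_eq_square)
    then show ?thesis unfolding c by (simp add: power2_eq_square algebra_simps)
  qed
  finally have "potential Q \<le> c * potential P" using d by simp
  then show ?thesis using pos by (simp add: c_def field_simps)
qed

lemma potential_pos:
  assumes P: "resolvent u l P" and h: "h \<in> S" "L2_norm M h \<noteq> 0"
  shows "0 < potential P"
proof -
  have "0 \<le> potential P" by (rule potential_nonneg[OF P])
  moreover have "0 < (u * rip h h - sample_energy l h) * potential P"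
    using L2_norm_le_shifted[OF P h(1)] h(2) by (meson less_le_trans zero_less_power2)
  ultimately show ?thesis by (cases "potential P = 0") auto
qed

text \<open>By the Sherman-Morrison formula, a point $z$ with weight $w$ is harmless if
  $\|Q k_z\|_2^2 / (\Phi(P) - \Phi(Q)) + \langle Q k_z, k_z\rangle \le 1/w$. The function
  \<open>U\<close> majorizes the left-hand side, first through $\|\cdot\|_2^2 \le \lambda\|\cdot\|^2$ and then
  through the bound of $\|Q k_z\|^2$ by diagonals. The bound for its integral
  improves on the classical $\lambda/d + \Phi(Q)$ by $(\lambda/\mathrm{Tr})\,\Phi(Q)$; this is
  where $\mathrm{Tr}-\lambda$ arises.\<close>

lemma upper_step:
  assumes P: "resolvent u l P" and Q: "resolvent (u + d) l Q" and d: "0 < d"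
    and T: "0 < Tr" and lam: "0 < lam"
    and emb: "\<And>f. f \<in> S \<Longrightarrow> (L2_norm M f)\<^sup>2 \<le> lam * rip f f"
    and h: "h \<in> S" "L2_norm M h \<noteq> 0"
  obtains U where "integrable M U" "\<And>x. x \<in> space M \<Longrightarrow> 0 \<le> U x"
    "(LINT x|M. U x) \<le> lam / d + (1 - lam / Tr) * potential Q"
    "\<And>z w. z \<in> space M \<Longrightarrow> 0 < w \<Longrightarrow> U z \<le> 1 / w \<Longrightarrow> w * diag Q z < 1 \<and>
      (\<exists>Q'. resolvent (u + d) ((w, z) # l) Q' \<and> potential Q' \<le> potential P)"
proof -
  define A B where "A = potential P" and "B = potential Q"
  have AB: "0 < A" "0 < B" using potential_pos[OF P h] potential_pos[OF Q h] by (simp_all add: A_def B_def)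
  have pair: "d * A * B \<le> Tr * (A - B)"
    using potential_pair[OF P Q d T] by (simp add: A_def B_def)
  moreover have "0 < d * A * B" using d AB by simp
  ultimately have gap: "0 < A - B" using T by (metis less_le_trans zero_less_mult_pos)
  \<comment> \<open>the mean value of $1 - d\,Q$ in the trace weighted by the embedding\<close>
  define c where "c = 1 - d * B / Tr"
  define U where "U x = lam * (c\<^sup>2 * diag P x + (1 - 2 * c) * diag Q x) / (d * (A - B)) + diag Q x" for x
  have N: "d * rip (Q (k x)) (Q (k x)) \<le> c\<^sup>2 * diag P x + (1 - 2 * c) * diag Q x"
    if "x \<in> space M" for x
    using upper_pair_bounds(1)[OF P Q kernel_mem[OF that] d] that
    by (simp add: diag_eq_rip[OF P] diag_eq_rip[OF Q])
  have U: "lam * rip (Q (k x)) (Q (k x)) / (A - B) + diag Q x \<le> U x" if "x \<in> space M" for x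
  proof -
    have "lam * (d * rip (Q (k x)) (Q (k x))) / (d * (A - B)) 
        \<le> lam * (c\<^sup>2 * diag P x + (1 - 2 * c) * diag Q x) / (d * (A - B))"
      using N[OF that] lam d gap by (intro divide_right_mono mult_left_mono) auto
    then show ?thesis using d by (simp add: U_def)
  qed
  show ?thesis
  proof
    show "integrable M U"
      unfolding U_def using resolvent_integrable[OF P] resolvent_integrable[OF Q] by simp
    show "0 \<le> U x" if "x \<in> space M" for x
      using U[OF that] lam gap rip_nonneg[of "Q (k x)"] diag_nonneg[OF Q that]
        resolvent_mem[OF Q kernel_mem[OF that]]
      by (meson add_nonneg_nonneg divide_nonneg_pos mult_nonneg_nonneg order_trans less_imp_le)
    have "(LINT x|M. U x) = lam * (c\<^sup>2 * A + (1 - 2 * c) * B) / (d * (A - B)) + B"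
      unfolding U_def A_def B_def potential_def
      using resolvent_integrable[OF P] resolvent_integrable[OF Q] by simp
    also have "\<dots> \<le> lam * (c * (A - B)) / (d * (A - B)) + B"
    proof -
      have "0 \<le> 1 - c" using d AB T by (simp add: c_def)
      moreover have "0 \<le> c * A - B" using pair T by (simp add: c_def field_simps)
      ultimately have "0 \<le> (1 - c) * (c * A - B)" by simp
      then have "c\<^sup>2 * A + (1 - 2 * c) * B \<le> c * (A - B)"
        by (simp add: power2_eq_square algebra_simps)
      then show ?thesis using lam d gap by (intro add_right_mono divide_right_mono mult_left_mono) auto
    qed
    also have "\<dots> = lam / d + (1 - lam / Tr) * potential Q"
      using gap d T by (simp add: c_def B_def[symmetric] field_simps)
    finally show "(LINT x|M. U x) \<le> lam / d + (1 - lam / Tr) * potential Q" .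
  next
    fix z w assume z: "z \<in> space M" and w: "0 < w" and Uw: "U z \<le> 1 / w"
    define b N where "b = diag Q z" and "N = rip (Q (k z)) (Q (k z))"
    have Qk: "Q (k z) \<in> S" using z by (intro resolvent_mem[OF Q] kernel_mem)
    have N0: "0 \<le> N" unfolding N_def by (rule rip_nonneg[OF Qk])
    have bN: "lam * N / (A - B) + b \<le> 1 / w"
      using U[OF z] Uw by (simp add: b_def N_def)
    have wb: "w * b < 1"
    proof (cases "Q (k z) = 0")
      case True
      then show ?thesis by (simp add: b_def diag_def)
    next
      case False
      then have "0 < lam * N / (A - B)" using rip_pos[OF Qk] lam gap by (simp add: N_def)
      with bN have "b < 1 / w" by simp
      then show ?thesis using w by (simp add: field_simps)
    qed
    have "w * (lam * N / (A - B) + b) \<le> 1" using bN w by (simp add: field_simps)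
    then have "w * (lam * N) \<le> (A - B) * (1 - w * b)"
      using gap by (simp add: field_simps)
    then have "w * (lam * N) / (1 - w * b) \<le> A - B"
      using wb by (simp add: divide_le_eq)
    moreover have "w / (1 - w * b) * (L2_norm M (Q (k z)))\<^sup>2 \<le> w / (1 - w * b) * (lam * N)"
      using emb[OF Qk] w wb by (intro mult_left_mono) (simp_all add: N_def)
    ultimately have "B + w / (1 - w * b) * (L2_norm M (Q (k z)))\<^sup>2 \<le> A" by simp
    then show "w * diag Q z < 1 \<and>
      (\<exists>Q'. resolvent (u + d) ((w, z) # l) Q' \<and> potential Q' \<le> potential P)"
      using resolvent_insert[OF Q z, of w] wb by (auto simp: A_def B_def b_def)
  qed
qed

text \<open>In finite dimension, expand in an orthonormal basis $(e)$ for the form of $A_u$: the inverse is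
  $P f = \sum_e \langle f, e\rangle e$, with coefficients taken in the original inner product.\<close>

lemma resolvent_exists:
  assumes adm: "admissible l" and dim: "0 < fun_vs.dim S"
    and pos: "\<And>f. f \<in> S \<Longrightarrow> f \<noteq> 0 \<Longrightarrow> 0 < u * rip f f - sample_energy l f"
  shows "\<exists>P. resolvent u l P"
proof -
  define ip' where "ip' f g = ip (shifted u l f) g" for f g
  note [simp] = shifted_mem[OF adm]
  have ip'_alt: "ip' f g = ip f (shifted u l g)" if "f \<in> S" "g \<in> S" for f g
    using that adm by (simp add: ip'_def ip_shifted_swap)
  interpret F: function_inner_space "space M" S ip'
  proof
    show "ip' (f + g) h = ip' f h + ip' g h" if "f \<in> S" "g \<in> S" "h \<in> S" for f g h
      using that by (simp add: ip'_def shifted_add ip_add_left)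
    show "ip' (fscale c f) g = c * ip' f g" if "f \<in> S" "g \<in> S" for c f g
      using that by (simp add: ip'_def shifted_scale ip_scale_left)
    show "ip' g f = cnj (ip' f g)" if "f \<in> S" "g \<in> S" for f g
      using that ip_cnj[of f "shifted u l g"] ip'_alt[OF that] by (simp add: ip'_def)
    show "0 < Re (ip' f f)" if "f \<in> S" "f \<noteq> 0" for f
      using pos[OF that] that adm by (simp add: ip'_def flip: rip_def rip_shifted)
  qed (fact subspace zero_outside)+
  obtain E where E: "F.orthonormal E" and ex: "\<And>f. f \<in> S \<Longrightarrow> F.expansion E f = f"
    using F.orthonormal_basis_exists[OF dim] by blast
  have ES: "E \<subseteq> S" "finite E" using E by (auto simp: F.orthonormal_def)
  define P where "P = expansion E"
  have P: "P f \<in> S" for f unfolding P_def by (rule expansion_mem[OF ES(1)])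
  have ipP: "ip (P f) g = (\<Sum>e\<in>E. ip f e * ip e g)" if "g \<in> S" for f g
    unfolding P_def using ES that by (simp add: ip_expansion_left)
  have ipP': "ip f (P g) = (\<Sum>e\<in>E. ip f e * ip e g)" if "f \<in> S" "g \<in> S" for f g
    using that ip_cnj[OF P that(1), of g] ES ip_cnj[of f] ip_cnj[of _ g]
    by (auto simp: ipP subset_iff mult.commute intro!: sum.cong)
  have inv: "shifted u l (P f) = f" if f: "f \<in> S" for f
  proof (rule eq_if_ip_diff_0)
    show "ip (shifted u l (P f)) g = ip f g" if g: "g \<in> S" for g
    proof -
      have "ip (shifted u l (P f)) g = ip (P f) (shifted u l g)"
        using g by (simp add: ip_shifted_swap[OF adm] P)
      also have "\<dots> = ip f (P (shifted u l g))"
        using f g by (simp add: ipP ipP')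
      also have "P (shifted u l g) = F.expansion E g"
        unfolding P_def expansion_def F.expansion_def ip'_def ..
      finally show ?thesis using ex[OF g] by simp
    qed
  qed (use f P in simp_all)
  have diagP: "diag P x = (\<Sum>e\<in>E. (cmod (e x))\<^sup>2)" if x: "x \<in> space M" for x
  proof -
    have "P (k x) x = ip (P (k x)) (k x)" using x P by (simp add: ip_kernel)
    also have "\<dots> = (\<Sum>e\<in>E. cnj (e x) * e x)"
      using x ES by (auto simp: ipP kernel_mem ip_kernel ip_kernel_left intro!: sum.cong)
    finally show ?thesis by (simp add: diag_def cmod_power2) (simp add: power2_eq_square)
  qed
  have "resolvent u l P"
    unfolding resolvent_def
  proof (intro conjI ballI)
    show "integrable M (diag P)"
      using ES diagP L2_mem by (subst Bochner_Integration.integrable_cong[of _ M]) (auto simp: subset_iff)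
    show "0 \<le> rip (P f) f" if "f \<in> S" for f
    proof -
      have "ip (P f) f = (\<Sum>e\<in>E. ip f e * cnj (ip f e))"
        using that ES ip_cnj[of f] by (auto simp: ipP intro!: sum.cong)
      then show ?thesis by (simp add: rip_def sum_nonneg)
    qed
  qed (use adm inv P ipP ipP' in simp_all)
  then show ?thesis by (intro exI[of _ P])
qed

text \<open>Here the embedding into $L_2$ is isometric, $Q$ is the current inverse, and $P$ the one after
  the barrier has been lowered; it exists since $d\,\Phi(Q) < 1$ keeps the form positive. A
  point with weight $w$ restores the potential if
  $1/w \le \|P k_z\|^2/(\Phi(P)-\Phi(Q)) - \langle P k_z, k_z\rangle$, and \<open>L\<close> minorizes this
  by diagonals. The bound on its integral is sharp when all eigenvalues of the form agree.\<close>

lemma lower_step: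
  assumes Q: "resolvent u l Q" and d: "0 < d" "d * potential Q < 1"
    and T: "1 \<le> Tr" and dim: "0 < fun_vs.dim S"
    and iso: "\<And>f. f \<in> S \<Longrightarrow> (L2_norm M f)\<^sup>2 = rip f f"
    and h: "h \<in> S" "L2_norm M h \<noteq> 0"
  obtains L where "integrable M L"
    "1 / d - (Tr - 1) * potential Q / (Tr - d * potential Q) \<le> (LINT x|M. L x)"
    "\<And>z w. z \<in> space M \<Longrightarrow> 0 < w \<Longrightarrow> 1 / w \<le> L z \<Longrightarrow>
      (\<exists>P'. resolvent (u - d) ((- w, z) # l) P' \<and> potential P' \<le> potential Q)"
proof -
  note Q0 = potential_pos[OF Q h]
  have "\<exists>P. resolvent (u - d) l P"
  proof (rule resolvent_exists[OF resolvent_admissible[OF Q] dim])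
    fix f assume f: "f \<in> S" "f \<noteq> 0"
    define X where "X = u * rip f f - sample_energy l f"
    have r: "0 < rip f f" using rip_pos f by simp
    have le: "rip f f \<le> X * potential Q"
      using L2_norm_le_shifted[OF Q f(1)] iso f by (simp add: X_def)
    then have "0 < X" using r Q0 by (metis less_le_trans zero_less_mult_pos2)
    then have "d * (X * potential Q) < X" using d by (simp add: mult.left_commute)
    then have "d * rip f f < X" using le d by (meson le_less_trans mult_left_mono less_imp_le)
    then show "0 < (u - d) * rip f f - sample_energy l f" by (simp add: X_def algebra_simps)
  qed
  then obtain P where P: "resolvent (u - d) l P" ..
  have Q': "resolvent (u - d + d) l Q" using Q by simp
  define A B where "A = potential P" and "B = potential Q"
  have AB: "0 < A" "0 < B" using potential_pos[OF P h] Q0 by (simp_all add: A_def B_def)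
  have pair: "d * A * B \<le> Tr * (A - B)"
    using potential_pair[OF P Q' d(1)] T by (simp add: A_def B_def)
  moreover have "0 < d * A * B" using d AB by simp
  ultimately have gap: "0 < A - B" using T by (meson less_le_trans zero_less_mult_pos zero_less_one)
  \<comment> \<open>the optimal parameter in the integrated lower bound\<close>
  define t where "t = (A - B) / B"
  define L where "L x = ((1 + 2 * t) * diag P x - (1 + t)\<^sup>2 * diag Q x) / (d * (A - B)) - diag P x" for x
  show ?thesis
  proof
    show "integrable M L"
      unfolding L_def using resolvent_integrable[OF P] resolvent_integrable[OF Q] by simp
    have dB: "0 < 1 - d * B" "0 < Tr - d * B" using d T by (simp_all add: B_def)
    have tB: "t * B = A - B" using AB by (simp add: t_def)
    have "(LINT x|M. L x) = ((1 + 2 * t) * A - (1 + t)\<^sup>2 * B) / (d * (A - B)) - A"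
      unfolding L_def A_def B_def potential_def
      using resolvent_integrable[OF P] resolvent_integrable[OF Q] by simp
    also have "(1 + 2 * t) * A - (1 + t)\<^sup>2 * B = (1 + 2 * t) * (A - B) - t * (t * B)"
      by (simp add: power2_eq_square algebra_simps)
    also have "\<dots> = (1 + t) * (A - B)" unfolding tB by (simp add: algebra_simps)
    also have "(1 + t) * (A - B) / (d * (A - B)) - A = 1 / d + (A - B) * ((1 - d * B) / (d * B)) - B"
      using gap d(1) AB by (simp add: t_def) (simp add: field_simps)
    finally have int: "(LINT x|M. L x) = 1 / d + (A - B) * ((1 - d * B) / (d * B)) - B" .
    have "d * B * B / (Tr - d * B) \<le> A - B"
      unfolding pos_divide_le_eq[OF dB(2)] using pair by (simp add: algebra_simps)
    then have "d * B * B / (Tr - d * B) * ((1 - d * B) / (d * B)) \<le> (A - B) * ((1 - d * B) / (d * B))"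
      using dB d(1) AB by (intro mult_right_mono) auto
    moreover have "d * B * B / (Tr - d * B) * ((1 - d * B) / (d * B)) - B = - ((Tr - 1) * B / (Tr - d * B))"
      using dB d(1) AB by (simp add: divide_simps) (simp add: algebra_simps)
    ultimately show "1 / d - (Tr - 1) * potential Q / (Tr - d * potential Q) \<le> (LINT x|M. L x)"
      using int by (simp add: B_def)
  next
    fix z w assume z: "z \<in> space M" and w: "0 < w" and Lw: "1 / w \<le> L z"
    define a N where "a = diag P z" and "N = rip (P (k z)) (P (k z))"
    have a0: "0 \<le> a" unfolding a_def by (rule diag_nonneg[OF P z])
    have Pk: "P (k z) \<in> S" using z by (intro resolvent_mem[OF P] kernel_mem)
    have "((1 + 2 * t) * diag P z - (1 + t)\<^sup>2 * diag Q z) / (d * (A - B)) \<le> d * N / (d * (A - B))"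
      using lower_pair_bound[OF P Q' kernel_mem[OF z], of t] d gap z
      by (intro divide_right_mono) (simp_all add: N_def diag_eq_rip[OF P] diag_eq_rip[OF Q])
    then have "1 / w \<le> N / (A - B) - a" using Lw d by (simp add: L_def a_def)
    then have "(A - B) * (1 + w * a) \<le> w * N"
      using w gap by (simp add: field_simps)
    moreover have wa: "0 < 1 + w * a" using w a0 by (simp add: add_pos_nonneg)
    ultimately have "A - B \<le> w * N / (1 + w * a)" by (simp add: le_divide_eq)
    then have "A + - w / (1 - - w * a) * (L2_norm M (P (k z)))\<^sup>2 \<le> B"
      by (simp add: iso[OF Pk] N_def)
    moreover have "- w * a < 1" using wa by simp
    ultimately show "\<exists>P'. resolvent (u - d) ((- w, z) # l) P' \<and> potential P' \<le> potential Q"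
      using resolvent_insert[OF P z, of "- w"] by (auto simp: A_def B_def a_def)
  qed
qed

end

section \<open>Running both barriers\<close>

text \<open>The interface between the two barrier arguments and the choice of points: \<open>I j l\<close> is an
  invariant of the list \<open>l\<close> of the first \<open>j\<close> weighted points, and any point whose inverse weight
  respects a bound with controlled integral may be added.\<close>

definition upper_barrier ::
    "'a measure \<Rightarrow> real \<Rightarrow> (nat \<Rightarrow> (real \<times> 'a) list \<Rightarrow> bool) \<Rightarrow> bool" where
  "upper_barrier M c I \<longleftrightarrow> I 0 [] \<and> (\<forall>j l. I j l \<longrightarrow> (\<exists>U. integrable M U \<and> (\<forall>x\<in>space M. 0 \<le> U x)
    \<and> (LINT x|M. U x) \<le> c \<and> (\<forall>x\<in>space M. \<forall>w>0. U x \<le> 1 / w \<longrightarrow> I (Suc j) ((w, x) # l))))"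

definition lower_barrier ::
    "'a measure \<Rightarrow> real \<Rightarrow> (nat \<Rightarrow> (real \<times> 'a) list \<Rightarrow> bool) \<Rightarrow> bool" where
  "lower_barrier M c J \<longleftrightarrow> J 0 [] \<and> (\<forall>j l. J j l \<longrightarrow> (\<exists>L. integrable M L
    \<and> c \<le> (LINT x|M. L x) \<and> (\<forall>x\<in>space M. \<forall>w>0. 1 / w \<le> L x \<longrightarrow> J (Suc j) ((w, x) # l))))"

text \<open>Otherwise $L \le U$ everywhere, so that $U = L$ almost everywhere since $\int U \le \int L$.
  Then $L > 0$ almost nowhere, against $\int L > 0$.\<close>

lemma exists_point_below:
  fixes U L :: "'a \<Rightarrow> real"
  assumes U: "integrable M U" "\<And>x. x \<in> space M \<Longrightarrow> 0 \<le> U x" "(LINT x|M. U x) \<le> c"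
    and L: "integrable M L" "c \<le> (LINT x|M. L x)" and c: "0 < c"
  shows "\<exists>x\<in>space M. U x \<le> L x \<and> 0 < L x"
proof (rule ccontr)
  assume neg: "\<not> ?thesis"
  then have le: "0 \<le> U x - L x" if "x \<in> space M" for x
  proof -
    have "\<not> (U x \<le> L x \<and> 0 < L x)" using neg that by blast
    with U(2)[OF that] show ?thesis by linarith
  qed
  have int: "integrable M (\<lambda>x. U x - L x)" using U L by simp
  have "(LINT x|M. U x - L x) = 0"
    using U L Bochner_Integration.integral_nonneg[of M "\<lambda>x. U x - L x"] le by simp
  then have "AE x in M. U x - L x = 0"
    using integral_nonneg_eq_0_iff_AE[OF int] le by (simp add: AE_I2)
  then have "AE x in M. 0 \<le> - L x"
    using AE_space
  proof eventually_elim
    case (elim x)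
    then have "U x \<le> L x" by simp
    with neg elim(2) show ?case by (meson leI neg_0_le_iff_le)
  qed
  then have "0 \<le> (LINT x|M. - L x)" by (rule integral_nonneg_AE)
  with L c show False by simp
qed

lemma barriers_select:
  assumes I: "upper_barrier M c I" and J: "lower_barrier M c J" and c: "0 < c"
  shows "\<exists>l. length l = j \<and> (\<forall>(w, x)\<in>set l. 0 < w \<and> x \<in> space M) \<and> I j l \<and> J j l"
proof (induction j)
  case 0
  show ?case using I J by (auto simp: upper_barrier_def lower_barrier_def)
next
  case (Suc j)
  then obtain l where l: "length l = j" "\<forall>(w, x)\<in>set l. 0 < w \<and> x \<in> space M" "I j l" "J j l"
    by blast
  from I have "I j l \<longrightarrow> (\<exists>U. integrable M U \<and> (\<forall>x\<in>space M. 0 \<le> U x)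
      \<and> (LINT x|M. U x) \<le> c \<and> (\<forall>x\<in>space M. \<forall>w>0. U x \<le> 1 / w \<longrightarrow> I (Suc j) ((w, x) # l)))"
    unfolding upper_barrier_def by (elim conjE allE)
  from mp[OF this l(3)] obtain U where U: "integrable M U" "\<forall>x\<in>space M. 0 \<le> U x"
    "(LINT x|M. U x) \<le> c" "\<forall>x\<in>space M. \<forall>w>0. U x \<le> 1 / w \<longrightarrow> I (Suc j) ((w, x) # l)"
    by (elim exE conjE)
  from J have "J j l \<longrightarrow> (\<exists>L. integrable M L \<and> c \<le> (LINT x|M. L x)
      \<and> (\<forall>x\<in>space M. \<forall>w>0. 1 / w \<le> L x \<longrightarrow> J (Suc j) ((w, x) # l)))"
    unfolding lower_barrier_def by (elim conjE allE)
  from mp[OF this l(4)] obtain L where L: "integrable M L" "c \<le> (LINT x|M. L x)"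
    "\<forall>x\<in>space M. \<forall>w>0. 1 / w \<le> L x \<longrightarrow> J (Suc j) ((w, x) # l)"
    by (elim exE conjE)
  obtain x where x: "x \<in> space M" "U x \<le> L x" "0 < L x"
    using exists_point_below[OF U(1) _ U(3) L(1,2) c] U(2) by blast
  have "I (Suc j) ((1 / L x, x) # l)" "J (Suc j) ((1 / L x, x) # l)"
    using bspec[OF U(4) x(1), rule_format, of "1 / L x"]
      bspec[OF L(3) x(1), rule_format, of "1 / L x"] x by simp_all
  moreover have "length ((1 / L x, x) # l) = Suc j"
    "\<forall>(w, y)\<in>set ((1 / L x, x) # l). 0 < w \<and> y \<in> space M"
    using l x by auto
  ultimately show ?case by (intro exI conjI)
qed

lemma sample_energy_negate: "sample_energy (map (\<lambda>(w, x). (- w, x)) l) f = - sample_energy l f"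
  by (induction l) (auto simp: sample_energy_def)

text \<open>The lower barrier starts at $-(a+d)$ and moves by \<open>d\<close> in each of \<open>n\<close> steps. The optimal
  choice is $a = r(1-r)$ and $d = (1-r)/n$. For $m = 1$ this $a$ is zero, but any positive value is
  equally good then. The starting value exceeds \<open>a\<close> by \<open>d\<close> because the integral of the lower
  bound function is governed by $\Phi_0/(m - d\,\Phi_0) = 1/a$ for the initial potential
  $\Phi_0 = m/(a+d)$; the last inequality shows that the slack $1/\Phi_0$ in the final form makes up
  for this loss.\<close>

lemma lower_parameters:
  fixes m n :: nat
  assumes "1 \<le> m" "m \<le> n" "r = sqrt ((real m - 1) / real n)"
  obtains a d :: real where "0 < a" "0 < d" "(real m - 1) * d < a" "real n \<le> 1 / d - (real m - 1) / a"
    "(1 - r)\<^sup>2 \<le> real n * d - (a + d) * (real m - 1) / real m"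
proof -
  have n: "0 < real n" using assms by simp
  have r2: "r\<^sup>2 = (real m - 1) / real n" using assms by simp
  have "r < 1" using assms by simp
  define d where "d = (1 - r) / real n"
  have d: "0 < d" "real n * d = 1 - r" "1 / d = real n / (1 - r)" using \<open>r < 1\<close> n by (simp_all add: d_def)
  show ?thesis
  proof (cases "m = 1")
    case True
    then have "r = 0" using assms by simp
    with True d show ?thesis by (intro that[of 1 d]) simp_all
  next
    case False
    then have m: "1 < real m" using assms by simp
    then have r: "0 < r" using assms n by simp
    define a where "a = r * (1 - r)"
    have a: "0 < a" using r \<open>r < 1\<close> by (simp add: a_def)
    have "(real m - 1) * d = r\<^sup>2 * (1 - r)" unfolding r2 d_def by simp
    also have "\<dots> < a" using r \<open>r < 1\<close> by (simp add: a_def power2_eq_square)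
    finally have md: "(real m - 1) * d < a" .
    have m1: "real m - 1 = r\<^sup>2 * real n" unfolding r2 using n by simp
    have "1 / d - (real m - 1) / a = real n"
      unfolding m1 d(3) a_def using r \<open>r < 1\<close> by (simp add: divide_simps power2_eq_square) (simp add: algebra_simps)
    moreover have "(a + d) * (real m - 1) / real m \<le> a"
      using md m by (simp add: divide_le_eq algebra_simps)
    then have "(1 - r)\<^sup>2 \<le> real n * d - (a + d) * (real m - 1) / real m"
      unfolding d(2) by (simp add: a_def power2_eq_square algebra_simps)
    ultimately show ?thesis using a d md by (intro that[of a d]) simp_all
  qed
qed

context kernel_space
begin

lemma L2_norm_le_trace: "f \<in> S \<Longrightarrow> (L2_norm M f)\<^sup>2 \<le> Tr * rip f f"
  using L2_norm_le_shifted[OF resolvent_unscaled[of 1], of f] potential_unscaled[of 1]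
  by (simp add: sample_energy_def mult.commute)

text \<open>After the upper barrier has been raised, a new point must be compatible not only with the
  current inverse but with the inverses at all higher barriers, which are needed later. This
  follows from monotonicity.\<close>

lemma diag_antimono:
  assumes P: "resolvent u l P" and Q: "resolvent v l Q" and "u \<le> v" and x: "x \<in> space M"
  shows "diag Q x \<le> diag P x"
proof -
  have Q': "resolvent (u + (v - u)) l Q" using Q by simp
  have "rip (Q (k x)) (k x) \<le> rip (P (k x)) (k x)"
  proof (cases "u = v")
    case True
    then show ?thesis using resolvent_difference[OF P Q' kernel_mem[OF x]] by simp
  next
    case False
    with \<open>u \<le> v\<close> have d: "0 < v - u" by simp
    have "0 \<le> (v - u) * rip (Q (k x)) (Q (k x))"
      using d x by (simp add: rip_nonneg resolvent_mem[OF Q] kernel_mem)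
    with upper_pair_bounds(1)[OF P Q' kernel_mem[OF x] d, of 1] show ?thesis by simp
  qed
  then show ?thesis using x by (simp add: diag_eq_rip[OF P] diag_eq_rip[OF Q])
qed

text \<open>The barrier starts at $u_0 = \lambda(s+s^2)$ and grows by $d = \lambda(1+s)/n$ in each step, so
  that it ends at $\lambda(1+s)^2$, while the integral bound
  $\lambda/d + (\mathrm{Tr}-\lambda)/u_0$ equals \<open>n\<close>. For $s = 0$ the start would be degenerate;
  then $\mathrm{Tr} = \lambda$ and the trivial estimate
  $q(f) \le \|f\|^2 \sum_i w_i k(x_i,x_i)$ suffices.\<close>

lemma upper_barrier_exists:
  assumes n: "0 < n" and lam: "0 < lam" "lam \<le> Tr"
    and emb: "\<And>f. f \<in> S \<Longrightarrow> (L2_norm M f)\<^sup>2 \<le> lam * rip f f"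
    and h: "h \<in> S" "L2_norm M h \<noteq> 0"
    and s: "s = sqrt ((Tr - lam) / (real n * lam))"
  obtains I where "upper_barrier M (real n) I"
    "\<And>l f. I n l \<Longrightarrow> f \<in> S \<Longrightarrow> sample_energy l f \<le> (1 + s)\<^sup>2 * lam * rip f f"
proof (cases "lam = Tr")
  case True
  then have s0: "s = 0" using s by simp
  define I where "I j l \<longleftrightarrow> (\<forall>f\<in>S. sample_energy l f \<le> real j * (Tr / real n) * rip f f)" for j l
  have "upper_barrier M (real n) I"
    unfolding upper_barrier_def
  proof (intro conjI allI impI)
    show "I 0 []" by (simp add: I_def sample_energy_def)
    fix j l assume I: "I j l"
    define U where "U x = real n / Tr * Re (k x x)" for x
    have "I (Suc j) ((w, x) # l)" if x: "x \<in> space M" and w: "0 < w" and Uw: "U x \<le> 1 / w" for x w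
      unfolding I_def
    proof
      fix f assume f: "f \<in> S"
      have "(cmod (f x))\<^sup>2 \<le> rip f f * Re (k x x)"
        using resolvent_cauchy_schwarz[OF resolvent_unscaled[of 1] f kernel_mem[OF x]] f x
        by (simp add: rscale_def ip_kernel rip_kernel)
      then have "w * (cmod (f x))\<^sup>2 \<le> rip f f * (w * Re (k x x))"
        using w by (simp add: mult.left_commute)
      also have "w * Re (k x x) \<le> Tr / real n"
        using Uw w n lam by (simp add: U_def field_simps)
      then have "rip f f * (w * Re (k x x)) \<le> rip f f * (Tr / real n)"
        by (intro mult_left_mono rip_nonneg f)
      finally have "w * (cmod (f x))\<^sup>2 \<le> Tr / real n * rip f f" by (simp add: mult.commute)
      moreover have "sample_energy l f \<le> real j * (Tr / real n) * rip f f"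
        using I f by (simp add: I_def)
      ultimately show "sample_energy ((w, x) # l) f \<le> real (Suc j) * (Tr / real n) * rip f f"
        by (simp add: sample_energy_def algebra_simps add_divide_distrib)
    qed
    moreover have "integrable M U" "(LINT x|M. U x) \<le> real n"
      unfolding U_def using diagonal_integrable lam by (simp_all flip: kernel_trace_def)
    moreover have "0 \<le> U x" if "x \<in> space M" for x
      using that lam rip_nonneg[OF kernel_mem[OF that]] by (simp add: U_def rip_kernel)
    ultimately show "\<exists>U. integrable M U \<and> (\<forall>x\<in>space M. 0 \<le> U x) \<and> (LINT x|M. U x) \<le> real n \<and>
        (\<forall>x\<in>space M. \<forall>w>0. U x \<le> 1 / w \<longrightarrow> I (Suc j) ((w, x) # l))"
      by blast
  qed
  moreover have "sample_energy l f \<le> (1 + s)\<^sup>2 * lam * rip f f" if "I n l" "f \<in> S" for l f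
    using that n True s0 by (simp add: I_def)
  ultimately show ?thesis by (rule that)
next
  case False
  with lam have gap: "0 < Tr - lam" by simp
  define u0 where "u0 = lam * (s + s\<^sup>2)"
  define d where "d = lam * (1 + s) / real n"
  have s0: "0 < s" using s gap lam n by simp
  have s2: "Tr - lam = real n * lam * s\<^sup>2" using s gap lam n by simp
  have u0: "0 < u0" and d: "0 < d" using lam s0 n by (simp_all add: u0_def d_def add_pos_pos)
  have T: "0 < Tr" using lam by simp
  have "real n * d = lam * (1 + s)" using n by (simp add: d_def)
  then have end_eq: "u0 + real n * d = (1 + s)\<^sup>2 * lam"
    by (simp add: u0_def power2_eq_square algebra_simps)
  \<comment> \<open>the inverses at higher barriers provide those after the next shifts\<close>
  define I where "I j l \<longleftrightarrow> (\<exists>P. resolvent (u0 + real j * d) l P \<and> potential P \<le> Tr / u0)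
    \<and> (\<forall>v\<ge>u0 + real j * d. \<exists>P. resolvent v l P)" for j l
  have "upper_barrier M (real n) I"
    unfolding upper_barrier_def
  proof (intro conjI allI impI)
    have "\<exists>P. resolvent v [] P" if "u0 \<le> v" for v
      using resolvent_unscaled[of v] that u0 by auto
    then show "I 0 []"
      using resolvent_unscaled[OF u0] potential_unscaled[of u0] by (auto simp: I_def)
    fix j l assume I: "I j l"
    define u where "u = u0 + real j * d"
    obtain P where P: "resolvent u l P" "potential P \<le> Tr / u0"
      using I unfolding I_def u_def by blast
    have ex: "\<exists>P. resolvent v l P" if "u \<le> v" for v
      using I that unfolding I_def u_def by blast
    obtain Q where Q: "resolvent (u + d) l Q" using ex[of "u + d"] d by auto
    obtain U where U: "integrable M U" "\<And>x. x \<in> space M \<Longrightarrow> 0 \<le> U x"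
        "(LINT x|M. U x) \<le> lam / d + (1 - lam / Tr) * potential Q"
      and step: "\<And>z w. z \<in> space M \<Longrightarrow> 0 < w \<Longrightarrow> U z \<le> 1 / w \<Longrightarrow> w * diag Q z < 1 \<and>
        (\<exists>Q'. resolvent (u + d) ((w, z) # l) Q' \<and> potential Q' \<le> potential P)"
      using upper_step[OF P(1) Q d T lam(1) emb h] by blast
    have "0 \<le> d * potential P * potential Q"
      using d potential_nonneg[OF P(1)] potential_nonneg[OF Q] by simp
    then have "0 \<le> Tr * (potential P - potential Q)"
      using potential_pair[OF P(1) Q d T] by linarith
    then have "potential Q \<le> Tr / u0" using T P(2) by (simp add: zero_le_mult_iff)
    then have "(1 - lam / Tr) * potential Q \<le> (1 - lam / Tr) * (Tr / u0)"
      using lam T by (intro mult_left_mono) auto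
    also have "\<dots> = (Tr - lam) / u0" using T by (simp add: left_diff_distrib diff_divide_distrib)
    also have "\<dots> = real n * s / (1 + s)"
    proof -
      have "u0 = lam * (s * (1 + s))" by (simp add: u0_def power2_eq_square algebra_simps)
      then show ?thesis unfolding s2 using lam s0 by (simp add: power2_eq_square)
    qed
    finally have "(LINT x|M. U x) \<le> lam / d + real n * s / (1 + s)" using U(3) by simp
    also have "\<dots> = real n" using lam s0 n
      by (simp add: d_def divide_simps) (simp add: algebra_simps)
    finally have int: "(LINT x|M. U x) \<le> real n" .
    have "I (Suc j) ((w, x) # l)" if x: "x \<in> space M" and w: "0 < w" and Uw: "U x \<le> 1 / w" for x w
    proof -
      have j: "u0 + real (Suc j) * d = u + d" by (simp add: u_def algebra_simps)
      have "\<exists>P. resolvent v ((w, x) # l) P" if v: "u + d \<le> v" for v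
      proof -
        obtain R where R: "resolvent v l R" using ex[of v] v d by auto
        have "w * diag R x \<le> w * diag Q x"
          using diag_antimono[OF Q R v x] w by simp
        also have "\<dots> < 1" using step[OF x w Uw] by simp
        finally show ?thesis using resolvent_insert(1)[OF R x] by blast
      qed
      then show ?thesis unfolding I_def j using step[OF x w Uw] P(2) by (meson order_trans)
    qed
    then show "\<exists>U. integrable M U \<and> (\<forall>x\<in>space M. 0 \<le> U x) \<and> (LINT x|M. U x) \<le> real n \<and>
        (\<forall>x\<in>space M. \<forall>w>0. U x \<le> 1 / w \<longrightarrow> I (Suc j) ((w, x) # l))"
      using U int by blast
  qed
  moreover have "sample_energy l f \<le> (1 + s)\<^sup>2 * lam * rip f f" if "I n l" "f \<in> S" for l f
    using that sample_energy_le[of "u0 + real n * d" l _ f] unfolding I_def end_eq by blast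
  ultimately show ?thesis by (rule that)
qed

text \<open>The final list satisfies $u_n\|f\|^2 + q(f) \ge \|f\|^2/\Phi_0$ with $u_n = a + d - n d$ and
  $\Phi_0 = m/(a+d)$; this gives the claim by the choice of \<open>a\<close> and \<open>d\<close>.\<close>

lemma lower_barrier_exists:
  assumes m: "Tr = real m" "1 \<le> m" "m \<le> n" and dim: "0 < fun_vs.dim S"
    and iso: "\<And>f. f \<in> S \<Longrightarrow> (L2_norm M f)\<^sup>2 = rip f f"
    and h: "h \<in> S" "L2_norm M h \<noteq> 0"
    and r: "r = sqrt ((real m - 1) / real n)"
  obtains J where "lower_barrier M (real n) J"
    "\<And>l f. J n l \<Longrightarrow> f \<in> S \<Longrightarrow> (1 - r)\<^sup>2 * (L2_norm M f)\<^sup>2 \<le> sample_energy l f"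
proof -
  obtain a d where a: "0 < a" and d: "0 < d" and md: "(real m - 1) * d < a"
    and gain: "real n \<le> 1 / d - (real m - 1) / a"
    and final: "(1 - r)\<^sup>2 \<le> real n * d - (a + d) * (real m - 1) / real m"
    using lower_parameters[OF m(2,3) r] by blast
  have m0: "0 < real m" "1 \<le> real m" using m by simp_all
  define neg where "neg = map (\<lambda>(w :: real, x :: 'a). (- w, x))"
  define J where "J j l \<longleftrightarrow> (\<exists>Q. resolvent (a + d - real j * d) (neg l) Q
    \<and> potential Q \<le> real m / (a + d))" for j l
  have "lower_barrier M (real n) J"
    unfolding lower_barrier_def
  proof (intro conjI allI impI)
    show "J 0 []"
      using resolvent_unscaled[of "a + d"] potential_unscaled[of "a + d"] a d m
      by (auto simp: J_def neg_def)
    fix j l assume "J j l"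
    then obtain Q where Q: "resolvent (a + d - real j * d) (neg l) Q"
      and pot: "potential Q \<le> real m / (a + d)"
      by (auto simp: J_def)
    have pot': "potential Q * (a + d) \<le> real m" using pot a d by (simp add: field_simps)
    have dQ: "d * potential Q < 1"
    proof -
      have "d * potential Q \<le> d * (real m / (a + d))" using pot d by (intro mult_left_mono) auto
      also have "\<dots> < 1" using md a d by (simp add: field_simps)
      finally show ?thesis .
    qed
    have T: "1 \<le> Tr" using m by simp
    obtain L where L: "integrable M L"
      "1 / d - (Tr - 1) * potential Q / (Tr - d * potential Q) \<le> (LINT x|M. L x)"
      and step: "\<And>z w. z \<in> space M \<Longrightarrow> 0 < w \<Longrightarrow> 1 / w \<le> L z \<Longrightarrow>
        (\<exists>P'. resolvent (a + d - real j * d - d) ((- w, z) # neg l) P' \<and> potential P' \<le> potential Q)"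
      using lower_step[OF Q d dQ T dim iso h] by blast
    have den: "0 < real m - d * potential Q" using dQ m0 by linarith
    have "potential Q / (real m - d * potential Q) \<le> 1 / a"
      using den a pot' by (simp add: field_simps)
    then have "(real m - 1) * (potential Q / (real m - d * potential Q)) \<le> (real m - 1) * (1 / a)"
      using m0 by (intro mult_left_mono) auto
    then have int: "real n \<le> (LINT x|M. L x)" using L(2) gain m(1) by simp
    have "J (Suc j) ((w, x) # l)" if "x \<in> space M" "0 < w" "1 / w \<le> L x" for x w
    proof -
      have j: "a + d - real (Suc j) * d = a + d - real j * d - d" by (simp add: algebra_simps)
      show ?thesis using step[OF that] pot unfolding J_def j by (auto simp: neg_def intro: order_trans)
    qed
    then show "\<exists>L. integrable M L \<and> real n \<le> (LINT x|M. L x) \<and>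
        (\<forall>x\<in>space M. \<forall>w>0. 1 / w \<le> L x \<longrightarrow> J (Suc j) ((w, x) # l))"
      using L(1) int by blast
  qed
  moreover have "(1 - r)\<^sup>2 * (L2_norm M f)\<^sup>2 \<le> sample_energy l f" if J: "J n l" and f: "f \<in> S" for l f
  proof -
    obtain Q where Q: "resolvent (a + d - real n * d) (neg l) Q" 
      and pot: "potential Q \<le> real m / (a + d)"
      using J by (auto simp: J_def)
    define X where "X = (a + d - real n * d) * rip f f + sample_energy l f"
    have Q0: "0 < potential Q" by (rule potential_pos[OF Q h])
    have le: "rip f f \<le> X * potential Q"
      using L2_norm_le_shifted[OF Q f] iso[OF f] by (simp add: X_def neg_def sample_energy_negate)
    have "0 \<le> X * potential Q" using le rip_nonneg[OF f] by simp
    then have "0 \<le> X" using Q0 by (simp add: zero_le_mult_iff)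
    then have "rip f f \<le> X * (real m / (a + d))"
      using le pot by (meson mult_left_mono order_trans)
    then have "(a + d) / real m * rip f f \<le> X" using m0 a d by (simp add: field_simps)
    then have "(real n * d - (a + d) * (real m - 1) / real m) * rip f f \<le> sample_energy l f"
      using m0 by (simp add: X_def field_simps)
    moreover have "(1 - r)\<^sup>2 * rip f f \<le> (real n * d - (a + d) * (real m - 1) / real m) * rip f f"
      using final rip_nonneg[OF f] by (rule mult_right_mono)
    ultimately show ?thesis by (simp add: iso[OF f])
  qed
  ultimately show ?thesis by (rule that)
qed

end

section \<open>The $L_2$ inner product and weighted least squares\<close>

definition L2_ip :: "'a measure \<Rightarrow> ('a \<Rightarrow> complex) \<Rightarrow> ('a \<Rightarrow> complex) \<Rightarrow> complex" where
  "L2_ip M f g = (LINT x|M. f x * cnj (g x))"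

lemma L2_ip_integrable:
  assumes "f \<in> L2 M" "g \<in> L2 M"
  shows "integrable M (\<lambda>x. f x * cnj (g x))"
proof (rule Bochner_Integration.integrable_bound)
  show "integrable M (\<lambda>x. (cmod (f x))\<^sup>2 + (cmod (g x))\<^sup>2)"
    using assms by (auto simp: L2_def)
  show "(\<lambda>x. f x * cnj (g x)) \<in> borel_measurable M"
    using assms by (auto simp: L2_def intro!: borel_measurable_times borel_measurable_continuous_on[of cnj] continuous_intros)
  have "a * b \<le> a\<^sup>2 + b\<^sup>2" if "0 \<le> a" "0 \<le> b" for a b :: real
    using sum_squares_bound[of a b] that mult_nonneg_nonneg[OF that] by linarith
  then show "AE x in M. norm (f x * cnj (g x)) \<le> norm ((cmod (f x))\<^sup>2 + (cmod (g x))\<^sup>2)"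
    by (simp add: norm_mult)
qed

lemma Re_L2_ip: "f \<in> L2 M \<Longrightarrow> Re (L2_ip M f f) = (L2_norm M f)\<^sup>2"
proof -
  assume f: "f \<in> L2 M"
  have "Re (L2_ip M f f) = (LINT x|M. Re (f x * cnj (f x)))"
    unfolding L2_ip_def using L2_ip_integrable[OF f f] by (simp flip: integral_Re)
  also have "(\<lambda>x. Re (f x * cnj (f x))) = (\<lambda>x. (cmod (f x))\<^sup>2)"
    by (simp add: fun_eq_iff cmod_power2) (simp add: power2_eq_square)
  finally show ?thesis by (simp add: L2_norm_def)
qed

lemma ip_norm_L2_ip: "f \<in> L2 M \<Longrightarrow> ip_norm (L2_ip M) f = L2_norm M f"
  by (simp add: ip_norm_def Re_L2_ip) (simp add: L2_norm_def)

lemma L2_inner_space: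
  assumes sub: "fun_vs.subspace S" and L2: "S \<subseteq> L2 M"
    and zero: "\<And>f x. f \<in> S \<Longrightarrow> x \<notin> space M \<Longrightarrow> f x = 0"
    and inj: "\<And>f. f \<in> S \<Longrightarrow> f \<noteq> 0 \<Longrightarrow> L2_norm M f \<noteq> 0"
  shows "function_inner_space (space M) S (L2_ip M)"
proof
  have int: "integrable M (\<lambda>x. f x * cnj (g x))" if "f \<in> S" "g \<in> S" for f g
    using that L2 by (intro L2_ip_integrable) auto
  show "L2_ip M (f + g) h = L2_ip M f h + L2_ip M g h" if "f \<in> S" "g \<in> S" "h \<in> S" for f g h
    using int[OF that(1,3)] int[OF that(2,3)] by (simp add: L2_ip_def distrib_right)
  show "L2_ip M (fscale c f) g = c * L2_ip M f g" if "f \<in> S" "g \<in> S" for c f g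
    by (simp add: L2_ip_def fscale_def mult.assoc)
  show "L2_ip M g f = cnj (L2_ip M f g)" if "f \<in> S" "g \<in> S" for f g
    using Bochner_Integration.integral_cnj[of M "\<lambda>x. f x * cnj (g x)"] 
    by (simp add: L2_ip_def mult.commute)
  show "0 < Re (L2_ip M f f)" if "f \<in> S" "f \<noteq> 0" for f
    using inj[OF that] that L2 by (auto simp: Re_L2_ip)
qed (fact sub zero)+

lemma (in function_inner_space) kernel_of_orthonormal_basis:
  assumes E: "orthonormal E" and ex: "\<And>f. f \<in> H \<Longrightarrow> expansion E f = f"
  shows "reproducing_kernel D H ip (\<lambda>x. \<Sum>e\<in>E. fscale (cnj (e x)) e)"
  unfolding reproducing_kernel_def
proof (intro ballI conjI)
  fix x
  have EH: "E \<subseteq> H" "finite E" using E by (auto simp: orthonormal_def)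
  show "(\<Sum>e\<in>E. fscale (cnj (e x)) e) \<in> H" using EH by (intro sum_mem mem_scale) auto
  fix f assume f: "f \<in> H"
  have "ip f (\<Sum>e\<in>E. fscale (cnj (e x)) e) = (\<Sum>e\<in>E. ip f (fscale (cnj (e x)) e))"
    using EH f by (intro ip_sum_right mem_scale) auto
  also have "\<dots> = (\<Sum>e\<in>E. fscale (ip f e) e x)"
  proof (rule sum.cong)
    fix e assume "e \<in> E"
    then have "ip f (fscale (cnj (e x)) e) = e x * ip f e"
      using EH f by (subst ip_scale_right) auto
    then show "ip f (fscale (cnj (e x)) e) = fscale (ip f e) e x" by (simp add: fscale_def)
  qed simp
  also have "\<dots> = expansion E f x"
    unfolding expansion_def using EH(2) by (induction E rule: finite_induct) auto
  finally show "ip f (\<Sum>e\<in>E. fscale (cnj (e x)) e) = f x" using ex[OF f] by simp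
qed

lemma (in function_inner_space) ip_diff_expansion:
  assumes E: "orthonormal E" and f: "f \<in> H" and v: "v \<in> H" "expansion E v = v"
  shows "ip (f - expansion E f) v = 0"
proof -
  have EH: "E \<subseteq> H" "finite E" using E by (auto simp: orthonormal_def)
  define g where "g = f - expansion E f"
  have g: "g \<in> H" unfolding g_def by (intro mem_diff f expansion_mem EH)
  have "ip g e = 0" if "e \<in> E" for e
  proof -
    have "e \<in> H" using that EH by blast
    then show ?thesis
      using f ip_expansion_orthonormal[OF E that, of f] expansion_mem[OF EH(1), of f]
      by (simp add: g_def ip_diff_left)
  qed
  then have "ip (expansion E v) g = 0"
    using g EH ip_cnj[OF g] by (auto simp: ip_expansion_left subset_iff intro!: sum.neutral)
  then show ?thesis using v g ip_cnj[OF v(1) g] by (simp add: g_def)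
qed

definition sample_ip :: "(real \<times> 'a) list \<Rightarrow> ('a \<Rightarrow> complex) \<Rightarrow> ('a \<Rightarrow> complex) \<Rightarrow> complex" where
  "sample_ip l f g = (\<Sum>(w, x)\<leftarrow>l. of_real w * f x * cnj (g x))"

lemma sample_ip_linear:
  "sample_ip l (f + g) h = sample_ip l f h + sample_ip l g h"
  "sample_ip l (f - g) h = sample_ip l f h - sample_ip l g h"
  "sample_ip l h (f + g) = sample_ip l h f + sample_ip l h g"
  "sample_ip l (fscale c f) h = c * sample_ip l f h"
  "sample_ip l h (fscale c f) = cnj c * sample_ip l h f"
  "sample_ip l h 0 = 0"
  unfolding sample_ip_def by (induction l; force simp: fscale_def algebra_simps)+

lemma sample_ip_cnj: "sample_ip l g f = cnj (sample_ip l f g)"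
  unfolding sample_ip_def by (induction l) (auto simp: algebra_simps)

lemma sample_ip_self: "Re (sample_ip l f f) = sample_energy l f"
  unfolding sample_ip_def sample_energy_def
  by (induction l) (auto simp: cmod_power2 algebra_simps, simp add: power2_eq_square algebra_simps)

text \<open>The sample form is positive definite on \<open>V\<close>, so the minimizer is the expansion of \<open>f\<close> in an
  orthonormal basis of \<open>V\<close> for this form, although \<open>f\<close> may lie outside \<open>V\<close>. The Pythagorean
  identity then gives both uniqueness and the error bound.\<close>

lemma weighted_least_squares:
  assumes sub: "fun_vs.subspace V" and dim: "0 < fun_vs.dim V"
    and pos: "\<And>g. g \<in> V \<Longrightarrow> g \<noteq> 0 \<Longrightarrow> 0 < sample_energy l g"
  shows "\<exists>p\<in>V. \<forall>g\<in>V.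
    sample_energy l (f - g) = sample_energy l (f - p) + sample_energy l (p - g)"
proof -
  interpret V: function_inner_space UNIV V "sample_ip l"
  proof
    show "0 < Re (sample_ip l g g)" if "g \<in> V" "g \<noteq> 0" for g
      using pos[OF that] by (simp add: sample_ip_self)
  qed (use sub sample_ip_cnj in \<open>auto simp: sample_ip_linear\<close>)
  obtain E where E: "V.orthonormal E" and ex: "\<And>g. g \<in> V \<Longrightarrow> V.expansion E g = g"
    using V.orthonormal_basis_exists[OF dim] by blast
  have EV: "E \<subseteq> V" "finite E" using E by (auto simp: V.orthonormal_def)
  define p where "p = V.expansion E f"
  have p: "p \<in> V" unfolding p_def by (rule V.expansion_mem[OF EV(1)])
  have orthE: "sample_ip l (f - p) e = 0" if "e \<in> E" for e
    using V.ip_expansion_orthonormal[OF E that, of f] by (simp add: p_def sample_ip_linear)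
  have orth: "sample_ip l (f - p) g = 0" if g: "g \<in> V" for g
  proof -
    have "sample_ip l h (\<Sum>e\<in>E. fscale (c e) e) = (\<Sum>e\<in>E. cnj (c e) * sample_ip l h e)" for c h
      using EV(2)
      by (induction E rule: finite_induct) (simp_all only: sum.empty sum.insert sample_ip_linear not_False_eq_True)
    from this[of "f - p" "sample_ip l g"] show ?thesis
      using ex[OF g] orthE by (simp add: V.expansion_def)
  qed
  have "sample_energy l (f - g) = sample_energy l (f - p) + sample_energy l (p - g)"
    if g: "g \<in> V" for g
  proof -
    have *: "f - g = (f - p) + (p - g)" by simp
    have o: "sample_ip l (f - p) (p - g) = 0" by (intro orth V.mem_diff p g)
    then have "sample_ip l (p - g) (f - p) = 0" using sample_ip_cnj[of l "p - g" "f - p"] by simp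
    with o show ?thesis
      unfolding * sample_ip_self[symmetric] by (simp only: sample_ip_linear(1,3)) simp
  qed
  with p show ?thesis by blast
qed

lemma sample_energy_nth:
  "sample_energy l f = (\<Sum>i=1..length l. fst (l ! (i - 1)) * (cmod (f (snd (l ! (i - 1)))))\<^sup>2)"
proof -
  have "sample_energy l f = (\<Sum>i<length l. fst (l ! i) * (cmod (f (snd (l ! i))))\<^sup>2)"
    by (simp add: sample_energy_def sum_list_sum_nth case_prod_beta atLeast0LessThan)
  also have "\<dots> = (\<Sum>i=1..length l. fst (l ! (i - 1)) * (cmod (f (snd (l ! (i - 1)))))\<^sup>2)"
    by (rule sum.reindex_bij_witness[of _ "\<lambda>i. i - 1" Suc]) auto
  finally show ?thesis .
qed

section \<open>Sampling for the least squares approximation\<close>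

theorem corollary10:
  fixes M :: "'a measure"
    and H V H\<^sub>m :: "('a \<Rightarrow> complex) set"
    and ip :: "('a \<Rightarrow> complex) \<Rightarrow> ('a \<Rightarrow> complex) \<Rightarrow> complex"
    and K K\<^sub>m :: "'a \<Rightarrow> 'a \<Rightarrow> complex"
    and m n :: nat
    and lam r s :: real
  assumes "rkhs (space M) H ip"
    and "reproducing_kernel (space M) H ip K"
    and "H \<subseteq> L2 M"
    and "bdd_above ((\<lambda>f. (L2_norm M f)\<^sup>2 / (ip_norm ip f)\<^sup>2) ` (H - {0}))"
    and "\<forall>f \<in> H - {0}. L2_norm M f \<noteq> 0"
    and "integrable M (\<lambda>x. K x x)"
    and "fun_vs.subspace V" and "V \<subset> H" and "fun_vs.dim V = m" and "1 \<le> m"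
    and "m \<le> n"
    and "H\<^sub>m = orth_compl ip H V"
    and "reproducing_kernel (space M) H\<^sub>m ip K\<^sub>m"
    and "lam = (SUP f \<in> H\<^sub>m - {0}. (L2_norm M f)\<^sup>2 / (ip_norm ip f)\<^sup>2)"
    and "r = sqrt ((real m - 1) / real n)"
    and "s = sqrt ((kernel_trace M K\<^sub>m - lam) / (real n * lam))"
  shows "\<exists>(x :: nat \<Rightarrow> 'a) (w :: nat \<Rightarrow> real).
    (\<forall>i\<in>{1..n}. x i \<in> space M \<and> 0 < w i) \<and>
    (\<forall>f\<in>H.
      (\<exists>!g. is_arg_min (\<lambda>g. \<Sum>i=1..n. w i * (cmod (f (x i) - g (x i)))\<^sup>2) (\<lambda>g. g \<in> V) g) \<and>
      L2_norm M (f - (ARG_MIN (\<lambda>g. \<Sum>i=1..n. w i * (cmod (f (x i) - g (x i)))\<^sup>2) g. g \<in> V))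
        \<le> (1 + (1 + s) / (1 - r)) * sqrt lam * ip_norm ip (f - orth_proj ip V f))"
proof -
  note K = assms(2) and HL2 = assms(3) and bdd = assms(4) and inj = assms(5) and Kint = assms(6)
    and Vsub = assms(7) and VH = assms(8) and dimV = assms(9) and m = assms(10) and mn = assms(11)
    and Hm = assms(12) and Km = assms(13) and lam = assms(14) and r = assms(15) and s = assms(16)
  interpret H: rkhs "space M" H ip by (rule assms(1))
  have n: "0 < n" using m mn by simp
  have VH': "V \<subseteq> H" using VH by blast
  have dim0: "0 < fun_vs.dim V" using dimV m by simp
  have injH: "L2_norm M f \<noteq> 0" if "f \<in> H" "f \<noteq> 0" for f using inj that by blast
  interpret V: function_inner_space "space M" V ip
    using VH' Vsub by unfold_locales
      (auto simp: subset_iff H.ip_add_left H.ip_scale_left H.ip_pos H.zero_outside intro: H.ip_cnj)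
  interpret HL: function_inner_space "space M" H "L2_ip M"
    using H.zero_outside injH by (intro L2_inner_space H.subspace HL2)
  interpret VL: function_inner_space "space M" V "L2_ip M"
    using VH' HL2 H.zero_outside injH by (intro L2_inner_space Vsub) auto

  obtain E where E: "V.orthonormal E" and exE: "\<And>v. v \<in> V \<Longrightarrow> V.expansion E v = v"
    using V.orthonormal_basis_exists[OF dim0] by blast
  have EV: "E \<subseteq> V" "finite E" using E by (auto simp: V.orthonormal_def)
  have E_H: "H.orthonormal E" using E VH' by (auto simp: V.orthonormal_def H.orthonormal_def)
  have projV: "H.expansion E f \<in> V" for f
    by (rule V.expansion_mem[OF EV(1)])
  have proj_orth: "ip (f - H.expansion E f) v = 0" if "f \<in> H" "v \<in> V" for f v
    using that VH' exE by (intro H.ip_diff_expansion E_H) auto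
  have proj: "orth_proj ip V f = H.expansion E f" if f: "f \<in> H" for f
    unfolding orth_proj_def
  proof (rule the_equality)
    fix g assume g: "g \<in> V \<and> (\<forall>v\<in>V. ip (f - g) v = 0)"
    then have "g \<in> H" using VH' by blast
    show "g = H.expansion E f"
    proof (rule V.eq_if_ip_diff_0)
      fix v assume v: "v \<in> V"
      then have "v \<in> H" using VH' by blast
      then show "ip g v = ip (H.expansion E f) v"
        using g v proj_orth[OF f v] f \<open>g \<in> H\<close> projV[of f] VH'
        by (auto simp: H.ip_diff_left subset_iff)
    qed (use g projV in auto)
  qed (use projV proj_orth f in auto)
  have resid: "f - orth_proj ip V f \<in> H\<^sub>m" if f: "f \<in> H" for f
    using proj_orth[OF f] projV[of f] VH' f H.mem_diff[OF f, of "H.expansion E f"]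
    by (auto simp: Hm orth_compl_def proj[OF f])

  have HmH: "H\<^sub>m \<subseteq> H" by (auto simp: Hm orth_compl_def)
  have Hm_sub: "fun_vs.subspace H\<^sub>m"
    unfolding fun_vs.subspace_def Hm orth_compl_def using VH'
    by (auto simp: H.mem_simps H.ip_zero_left H.ip_add_left H.ip_scale_left subset_iff)
  interpret W: function_inner_space "space M" H\<^sub>m ip
    using HmH Hm_sub by unfold_locales
      (auto simp: subset_iff H.ip_add_left H.ip_scale_left H.ip_pos H.zero_outside intro: H.ip_cnj)
  \<comment> \<open>Subtracting the projection of $K_x$ to $V$ gives the kernel of the complement, so the diagonal of $K_m$ is integrable.\<close>
  have Km_diag: "Re (K\<^sub>m x x) = Re (K x x) - (\<Sum>e\<in>E. (cmod (e x))\<^sup>2)" if x: "x \<in> space M" for x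
  proof -
    have Kx: "K x \<in> H" "\<And>f. f \<in> H \<Longrightarrow> ip f (K x) = f x"
      and Kmx: "K\<^sub>m x \<in> H\<^sub>m" "\<And>f. f \<in> H\<^sub>m \<Longrightarrow> ip f (K\<^sub>m x) = f x"
      using K Km x by (auto simp: reproducing_kernel_def)
    define h where "h = K x - H.expansion E (K x)"
    have h: "h \<in> H\<^sub>m" using resid[OF Kx(1)] by (simp add: h_def proj[OF Kx(1)])
    have "K\<^sub>m x = h"
    proof (rule W.eq_if_ip_diff_0[OF Kmx(1) h])
      fix g assume g: "g \<in> H\<^sub>m"
      then have gH: "g \<in> H" and gV: "\<And>v. v \<in> V \<Longrightarrow> ip g v = 0" by (auto simp: Hm orth_compl_def)
      have "ip g h = g x"
        using gH Kx gV[OF projV] projV VH' by (auto simp: h_def H.ip_diff_right subset_iff)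
      then show "ip (K\<^sub>m x) g = ip h g"
        using W.ip_cnj[OF g Kmx(1)] W.ip_cnj[OF g h] Kmx(2)[OF g] by simp
    qed
    moreover have "H.expansion E (K x) x = (\<Sum>e\<in>E. cnj (e x) * e x)"
    proof -
      have "H.expansion E (K x) x = ip (H.expansion E (K x)) (K x)"
        using projV VH' by (intro Kx(2)[symmetric]) auto
      also have "\<dots> = (\<Sum>e\<in>E. ip (K x) e * ip e (K x))"
        using EV VH' Kx(1) by (intro H.ip_expansion_left) auto
      also have "\<dots> = (\<Sum>e\<in>E. cnj (e x) * e x)"
        using EV VH' Kx H.ip_cnj[of _ "K x"] by (intro sum.cong) (auto simp: subset_iff)
      finally show ?thesis .
    qed
    ultimately have "Re (K\<^sub>m x x) = Re (K x x) - (\<Sum>e\<in>E. Re (cnj (e x) * e x))"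
      by (simp add: h_def)
    also have "(\<lambda>e. Re (cnj (e x) * e x)) = (\<lambda>e. (cmod (e x))\<^sup>2)"
      by (simp add: fun_eq_iff cmod_power2) (simp add: power2_eq_square)
    finally show ?thesis .
  qed
  interpret W: kernel_space M H\<^sub>m ip K\<^sub>m
  proof
    show "H\<^sub>m \<subseteq> L2 M" using HmH HL2 by blast
    have "integrable M (\<lambda>x. Re (K x x) - (\<Sum>e\<in>E. (cmod (e x))\<^sup>2))"
      using Kint EV VH' HL2 by (intro Bochner_Integration.integrable_diff integrable_Re
          Bochner_Integration.integrable_sum) (auto simp: L2_def)
    then show "integrable M (\<lambda>x. Re (K\<^sub>m x x))"
      by (subst Bochner_Integration.integrable_cong[OF refl Km_diag])
  qed (rule Km)

  let ?q = "\<lambda>f. (L2_norm M f)\<^sup>2 / (ip_norm ip f)\<^sup>2"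
  obtain h where h: "h \<in> H\<^sub>m" "h \<noteq> 0"
  proof -
    obtain f where f: "f \<in> H" "f \<notin> V" using VH by blast
    have "f - orth_proj ip V f \<noteq> 0" using f projV[of f] by (auto simp: proj[OF f(1)])
    with resid[OF f(1)] show ?thesis by (rule that)
  qed
  have hL2: "L2_norm M h \<noteq> 0" using h HmH injH by blast
  have q_le: "?q f \<le> lam" if "f \<in> H\<^sub>m" "f \<noteq> 0" for f
    unfolding lam
  proof (rule cSUP_upper)
    show "bdd_above (?q ` (H\<^sub>m - {0}))" using HmH by (intro bdd_above_mono[OF bdd] image_mono) auto
  qed (use that in simp)
  have emb: "(L2_norm M f)\<^sup>2 \<le> lam * W.rip f f" if f: "f \<in> H\<^sub>m" for f
  proof (cases "f = 0")
    case True
    then show ?thesis using f by (simp add: L2_norm_def W.rip_def W.ip_zero)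
  next
    case False
    then show ?thesis using q_le[OF f False] W.rip_pos[OF f False]
      by (simp add: W.rip_ip_norm[OF f] divide_le_eq)
  qed
  have lam0: "0 < lam"
  proof -
    have "0 < ?q h" using hL2 W.rip_pos[OF h] by (simp add: W.rip_ip_norm[OF h(1)])
    also have "\<dots> \<le> lam" by (rule q_le[OF h])
    finally show ?thesis .
  qed
  have lam_tr: "lam \<le> kernel_trace M K\<^sub>m"
    unfolding lam
  proof (rule cSUP_least)
    show "?q f \<le> kernel_trace M K\<^sub>m" if "f \<in> H\<^sub>m - {0}" for f
      using that W.L2_norm_le_trace[of f] W.rip_pos[of f]
      by (auto simp: W.rip_ip_norm divide_le_eq)
  qed (use h in auto)
  obtain I where I: "upper_barrier M (real n) I"
    and upper: "\<And>l f. I n l \<Longrightarrow> f \<in> H\<^sub>m \<Longrightarrow> sample_energy l f \<le> (1 + s)\<^sup>2 * lam * W.rip f f"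
    using W.upper_barrier_exists[OF n lam0 lam_tr emb h(1) hL2 s] by blast

  obtain F where F: "VL.orthonormal F" "card F = m" and exF: "\<And>v. v \<in> V \<Longrightarrow> VL.expansion F v = v"
    using VL.orthonormal_basis_exists[OF dim0] dimV by auto
  have FV: "F \<subseteq> V" "finite F" using F by (auto simp: VL.orthonormal_def)
  have FL2: "e \<in> L2 M" if "e \<in> F" for e using that FV VH' HL2 by blast
  \<comment> \<open>the reproducing kernel of $V$ with the $L_2$ inner product; its trace is $m$\<close>
  define \<kappa> where "\<kappa> x = (\<Sum>e\<in>F. fscale (cnj (e x)) e)" for x
  have \<kappa>_diag: "Re (\<kappa> x x) = (\<Sum>e\<in>F. (cmod (e x))\<^sup>2)" for x
  proof -
    have "\<kappa> x y = (\<Sum>e\<in>F. cnj (e x) * e y)" for y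
      unfolding \<kappa>_def using FV(2) by (induction F rule: finite_induct) (auto simp: fscale_def)
    then have "Re (\<kappa> x x) = (\<Sum>e\<in>F. Re (cnj (e x) * e x))" by simp
    also have "(\<lambda>e. Re (cnj (e x) * e x)) = (\<lambda>e. (cmod (e x))\<^sup>2)"
      by (simp add: fun_eq_iff cmod_power2) (simp add: power2_eq_square)
    finally show ?thesis .
  qed
  interpret VK: kernel_space M V "L2_ip M" \<kappa>
  proof
    show "reproducing_kernel (space M) V (L2_ip M) \<kappa>"
      unfolding \<kappa>_def by (rule VL.kernel_of_orthonormal_basis[OF F(1) exF])
    show "V \<subseteq> L2 M" using VH' HL2 by blast
    show "integrable M (\<lambda>x. Re (\<kappa> x x))"
      using FL2 by (simp add: \<kappa>_diag L2_def)
  qed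
  have iso: "(L2_norm M f)\<^sup>2 = VK.rip f f" if "f \<in> V" for f
    using that VH' HL2 by (auto simp: VK.rip_def Re_L2_ip)
  have "kernel_trace M \<kappa> = (\<Sum>e\<in>F. (LINT x|M. (cmod (e x))\<^sup>2))"
    unfolding kernel_trace_def \<kappa>_diag using FL2 by (subst Bochner_Integration.integral_sum) (auto simp: L2_def)
  also have "\<dots> = (\<Sum>e\<in>F. 1)"
  proof (rule sum.cong)
    fix e assume e: "e \<in> F"
    have "(LINT x|M. (cmod (e x))\<^sup>2) = Re (L2_ip M e e)"
      using Re_L2_ip[OF FL2[OF e]] by (simp add: VK.L2_norm_power2)
    then show "(LINT x|M. (cmod (e x))\<^sup>2) = 1" using e F by (simp add: VL.orthonormal_def)
  qed simp
  finally have tr: "kernel_trace M \<kappa> = real m" using F(2) by simp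
  obtain e where "e \<in> F" using F(2) m by fastforce
  then have eV: "e \<in> V" and ee: "L2_ip M e e = 1" using FV F(1) by (auto simp: VL.orthonormal_def)
  have "e \<noteq> 0"
  proof
    assume "e = 0"
    with ee VL.ip_zero show False by simp
  qed
  then have e: "e \<in> V" "L2_norm M e \<noteq> 0" using eV injH[of e] VH' by auto
  obtain J where J: "lower_barrier M (real n) J"
    and lower: "\<And>l f. J n l \<Longrightarrow> f \<in> V \<Longrightarrow> (1 - r)\<^sup>2 * (L2_norm M f)\<^sup>2 \<le> sample_energy l f"
    using VK.lower_barrier_exists[OF tr m mn dim0 iso e r] by blast

  obtain l where l: "length l = n" "\<And>w x. (w, x) \<in> set l \<Longrightarrow> 0 < w \<and> x \<in> space M" "I n l" "J n l"
    using barriers_select[OF I J, of n] n by fastforce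
  have r1: "0 < 1 - r" using r m mn by simp
  have s0: "0 \<le> s" using s lam_tr lam0 by simp
  have energy_nonneg: "0 \<le> sample_energy l f" for f
    unfolding sample_energy_def using l(2) by (intro sum_list_nonneg) (auto simp: less_imp_le)
  have posV: "0 < sample_energy l g" if "g \<in> V" "g \<noteq> 0" for g
  proof -
    have "L2_norm M g \<noteq> 0" using that VH' injH by blast
    then have "0 < (1 - r)\<^sup>2 * (L2_norm M g)\<^sup>2" using r1 by simp
    also have "\<dots> \<le> sample_energy l g" by (rule lower[OF l(4) that(1)])
    finally show ?thesis .
  qed
  \<comment> \<open>list positions start at 0, the points at 1\<close>
  define x where "x i = snd (l ! (i - 1))" for i
  define w where "w i = fst (l ! (i - 1))" for i
  have energy: "(\<Sum>i=1..n. w i * (cmod (f (x i) - g (x i)))\<^sup>2) = sample_energy l (f - g)" for f g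
    by (simp add: sample_energy_nth l(1) w_def x_def)
  show ?thesis
  proof (intro exI[of _ x] exI[of _ w] conjI ballI)
    fix i assume "i \<in> {1..n}"
    then have "i - 1 < length l" using l(1) by auto
    then have "(w i, x i) \<in> set l" by (simp add: w_def x_def)
    then show "x i \<in> space M" "0 < w i" using l(2) by simp_all
  next
    fix f assume f: "f \<in> H"
    obtain p where p: "p \<in> V"
      and pyth_all: "\<forall>g\<in>V. sample_energy l (f - g) = sample_energy l (f - p) + sample_energy l (p - g)"
      by (rule bexE[OF weighted_least_squares[OF Vsub dim0 posV, of f]])
    have pyth: "sample_energy l (f - g) = sample_energy l (f - p) + sample_energy l (p - g)"
      if "g \<in> V" for g
      by (rule bspec[OF pyth_all that])
    have min: "is_arg_min (\<lambda>g. sample_energy l (f - g)) (\<lambda>g. g \<in> V) g \<longleftrightarrow> g = p" for g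
    proof
      assume g: "is_arg_min (\<lambda>g. sample_energy l (f - g)) (\<lambda>g. g \<in> V) g"
      then have gV: "g \<in> V" by (rule is_arg_min_linorder[THEN iffD1, THEN conjunct1])
      have "sample_energy l (f - g) \<le> sample_energy l (f - p)"
        using g p by (simp add: is_arg_min_linorder)
      then have le: "sample_energy l (p - g) \<le> 0" using pyth[OF gV] by simp
      have "p - g = 0"
      proof (rule ccontr)
        assume "p - g \<noteq> 0"
        with posV[OF V.mem_diff[OF p gV]] le show False by simp
      qed
      then show "g = p" by simp
    next
      have "sample_energy l (f - p) \<le> sample_energy l (f - g)" if "g \<in> V" for g
        using pyth[OF that] energy_nonneg[of "p - g"] by simp
      moreover assume "g = p"
      ultimately show "is_arg_min (\<lambda>g. sample_energy l (f - g)) (\<lambda>g. g \<in> V) g"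
        using p by (simp add: is_arg_min_linorder)
    qed
    have energy_f: "(\<lambda>g. \<Sum>i=1..n. w i * (cmod (f (x i) - g (x i)))\<^sup>2) = (\<lambda>g. sample_energy l (f - g))"
      by (rule ext) (rule energy)
    show "\<exists>!g. is_arg_min (\<lambda>g. \<Sum>i=1..n. w i * (cmod (f (x i) - g (x i)))\<^sup>2) (\<lambda>g. g \<in> V) g"
      unfolding energy_f min by (rule ex1I[of _ p]) (rule refl)
    have argmin: "(ARG_MIN (\<lambda>g. \<Sum>i=1..n. w i * (cmod (f (x i) - g (x i)))\<^sup>2) g. g \<in> V) = p"
      unfolding energy_f arg_min_def min by (rule some_eq_trivial)
    define y where "y = orth_proj ip V f"
    define h where "h = f - y"
    define N where "N = ip_norm ip h"
    have y: "y \<in> V" using projV by (simp add: y_def proj[OF f])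
    have h: "h \<in> H\<^sub>m" using resid[OF f] by (simp add: h_def y_def)
    have N: "N\<^sup>2 = W.rip h h" "0 \<le> N" 
      using W.rip_ip_norm[OF h] W.rip_nonneg[OF h] by (simp_all add: N_def ip_norm_def W.rip_def)
    have yp: "y - p \<in> V" by (rule V.mem_diff[OF y p])
    have "(L2_norm M h)\<^sup>2 \<le> (sqrt lam * N)\<^sup>2"
      using emb[OF h] lam0 N by (simp add: power_mult_distrib)
    then have 1: "L2_norm M h \<le> sqrt lam * N"
      by (rule power2_le_imp_le) (use lam0 N in simp)
    have "((1 - r) * L2_norm M (y - p))\<^sup>2 \<le> sample_energy l (y - p)"
      using lower[OF l(4) yp] by (simp add: power_mult_distrib)
    also have "\<dots> = sample_energy l (p - y)"
      by (simp add: sample_energy_def norm_minus_commute)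
    also have "\<dots> \<le> sample_energy l h"
      using pyth[OF y] energy_nonneg[of "f - p"] by (simp add: h_def)
    also have "\<dots> \<le> ((1 + s) * (sqrt lam * N))\<^sup>2"
      using upper[OF l(3) h] lam0 N by (simp add: power_mult_distrib mult.assoc)
    finally have "(1 - r) * L2_norm M (y - p) \<le> (1 + s) * (sqrt lam * N)"
      by (rule power2_le_imp_le) (use lam0 N s0 in simp)
    then have 2: "L2_norm M (y - p) \<le> (1 + s) / (1 - r) * (sqrt lam * N)"
      using r1 by (simp add: le_divide_eq mult.commute)
    have hH: "h \<in> H" and ypH: "y - p \<in> H" using h yp HmH VH' by auto
    have "L2_norm M (f - p) = L2_norm M (h + (y - p))" by (simp add: h_def)
    also have "\<dots> \<le> L2_norm M h + L2_norm M (y - p)"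
      using HL.ip_norm_triangle[OF hH ypH] hH ypH H.mem_add[OF hH ypH] HL2
      by (simp add: ip_norm_L2_ip subset_iff)
    also have "\<dots> \<le> (1 + (1 + s) / (1 - r)) * sqrt lam * N"
      using 1 2 by (simp add: distrib_right mult.assoc)
    finally show "L2_norm M (f - (ARG_MIN (\<lambda>g. \<Sum>i=1..n. w i * (cmod (f (x i) - g (x i)))\<^sup>2) g. g \<in> V))
        \<le> (1 + (1 + s) / (1 - r)) * sqrt lam * ip_norm ip (f - orth_proj ip V f)"
      unfolding argmin by (simp add: N_def h_def y_def)
  qed
qed

end
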